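(* Let $(\mathcal{A},\mathbf{F})$ be a $\mathcal{B}$-valued $C^*$-probability space and let $x_1,\dots,x_n\in\mathcal{A}$. Let $P=P(x_1,\dots,x_n)\in\mathcal{B}\langle x_1,\dots,x_n,x_1^*,\dots,x_n^*\rangle$ be a self-adjoint $\mathcal{B}$-valued polynomial in $x_1,\dots,x_n$ and their adjoints. Then there exist $m\geq 1$ and an element $L_P\in M_m(\mathbb{C})\otimes\mathcal{A}$ such that: (1) $L_P=c_1\otimes x_1+c_1^*\otimes x_1^*+\dots+c_n\otimes x_n+c_n^*\otimes x_n^*+c$, with $c\in M_m(\mathbb{C})\otimes\mathcal{B}$ and $c_i\in M_m(\mathbb{C})$ for $1\le i\le n$. (2) For every $b\in\mathbb{H}^+(\mathcal{B})$, setting $\Lambda_{\varepsilon}(b)=\mathrm{diag}(b,i\varepsilon,i\varepsilon,\dots,i\varepsilon)\in M_m(\mathbb{C})\otimes\mathcal{B}$ for $\varepsilon>0$, one has $$G^{\mathcal{B}}_{P}(b)=\lim_{\varepsilon\downarrow 0}\left(G^{M_m(\mathbb{C})\otimes\mathcal{B}}_{L_P}(\Lambda_{\varepsilon}(b))\right)_{11},$$ where $(\cdot)_{11}$ denotes the $(1,1)$ entry of an $m\times m$ matrix over $\mathcal{B}$.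
   Context: A $\mathcal{B}$-valued $C^*$-probability space $(\mathcal{A},\mathbf{F})$ consists of a unital $C^*$-algebra $\mathcal{A}$, a $C^*$-subalgebra $\mathcal{B}\subseteq\mathcal{A}$ containing the unit of $\mathcal{A}$, and a conditional expectation $\mathbf{F}:\mathcal{A}\to\mathcal{B}$, i.e. a positive linear map with $\mathbf{F}(bab')=b\mathbf{F}(a)b'$ for all $b,b'\in\mathcal{B}$, $a\in\mathcal{A}$, and $\mathbf{F}(1)=1$. $\mathcal{B}\langle x_1,\dots,x_n,x_1^*,\dots,x_n^*\rangle$ denotes the $*$-subalgebra of $\mathcal{A}$ generated by $\mathcal{B}$ and $x_1,\dots,x_n$; its elements ($\mathcal{B}$-valued polynomials) are finite sums of monomials $b_0 y_1 b_1 y_2\cdots y_k b_k$ with $b_j\in\mathcal{B}$ and $y_j\in\{x_1,\dots,x_n,x_1^*,\dots,x_n^*\}$. Self-adjoint means $P=P^*$ in $\mathcal{A}$. $M_m(\mathbb{C})\otimes\mathcal{A}$ is identified with the $m\times m$ matrices over $\mathcal{A}$, and is an $(M_m(\mathbb{C})\otimes\mathcal{B})$-valued probability space with the entrywise conditional expectation $\mathrm{id}_m\otimes\mathbf{F}$. The operatorial upper half-plane is $\mathbb{H}^+(\mathcal{B})=\{b\in\mathcal{B}:\exists\,\varepsilon>0\text{ such that }-i(b-b^* )\geq\varepsilon\cdot 1\}$. The operator-valued Cauchy transforms are $G^{\mathcal{B}}_x(b)=\mathbf{F}((b-x)^{-1})$ for $x\in\mathcal{A}$, $b\in\mathcal{B}$,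 and $G^{M_m(\mathbb{C})\otimes\mathcal{B}}_X(\beta)=(\mathrm{id}_m\otimes\mathbf{F})((\beta-X)^{-1})$ for $X\in M_m(\mathbb{C})\otimes\mathcal{A}$, $\beta\in M_m(\mathbb{C})\otimes\mathcal{B}$, whenever the inverses exist. The limit is in norm. *)

theory Defs
  imports "Jordan_Normal_Form.Schur_Decomposition"
begin

section \<open>Unital \<open>C\<^sup>*\<close>-algebras\<close>

text \<open>The library has real normed algebras only, so the complex scalar multiplication and the
  involution are added here. The real scaling is the restriction of the complex one, and the class
  \<^class>\<open>real_normed_algebra_1\<close> makes the algebra unital and non-zero.\<close>

class cstar_algebra = real_normed_algebra_1 + banach +
  fixes scaleC :: "complex \<Rightarrow> 'a \<Rightarrow> 'a" (infixr "*\<^sub>C" 75)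
    and star :: "'a \<Rightarrow> 'a"
  assumes scaleR_scaleC: "r *\<^sub>R a = complex_of_real r *\<^sub>C a"
    and scaleC_add_right: "z *\<^sub>C (a + b) = z *\<^sub>C a + z *\<^sub>C b"
    and scaleC_add_left: "(z + w) *\<^sub>C a = z *\<^sub>C a + w *\<^sub>C a"
    and scaleC_scaleC: "z *\<^sub>C (w *\<^sub>C a) = (z * w) *\<^sub>C a"
    and mult_scaleC_left: "(z *\<^sub>C a) * b = z *\<^sub>C (a * b)"
    and mult_scaleC_right: "a * (z *\<^sub>C b) = z *\<^sub>C (a * b)"
    and norm_scaleC: "norm (z *\<^sub>C a) = cmod z * norm a"
    and star_star: "star (star a) = a"
    and star_add: "star (a + b) = star a + star b"
    and star_mult: "star (a * b) = star b * star a"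
    and star_scaleC: "star (z *\<^sub>C a) = cnj z *\<^sub>C star a"
    and cstar_identity: "norm (star a * a) = (norm a)\<^sup>2"

definition star_subalgebra :: "'a::cstar_algebra set \<Rightarrow> bool" where
  "star_subalgebra S \<longleftrightarrow> 0 \<in> S \<and> (\<forall>a\<in>S. \<forall>b\<in>S. a + b \<in> S \<and> a * b \<in> S) \<and>
     (\<forall>a\<in>S. \<forall>z. z *\<^sub>C a \<in> S) \<and> (\<forall>a\<in>S. star a \<in> S)"

definition unital_cstar_subalgebra :: "'a::cstar_algebra set \<Rightarrow> bool" where
  "unital_cstar_subalgebra B \<longleftrightarrow> star_subalgebra B \<and> closed B \<and> 1 \<in> B"

definition is_inverse :: "'a::cstar_algebra \<Rightarrow> 'a \<Rightarrow> bool" where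
  "is_inverse a y \<longleftrightarrow> a * y = 1 \<and> y * a = 1"

definition invertible_elem :: "'a::cstar_algebra \<Rightarrow> bool" where
  "invertible_elem a \<longleftrightarrow> (\<exists>y. is_inverse a y)"

definition elem_inv :: "'a::cstar_algebra \<Rightarrow> 'a" where
  "elem_inv a = (THE y. is_inverse a y)"

text \<open>Spectrum, positivity and order are relative to a unital \<open>C\<^sup>*\<close>-subalgebra \<open>B\<close>: inverses are
  sought in \<open>B\<close>. For the ambient algebra take \<open>B = UNIV\<close>.\<close>

definition spectrum_in :: "'a::cstar_algebra set \<Rightarrow> 'a \<Rightarrow> complex set" where
  "spectrum_in B a = {z. \<not> (\<exists>y\<in>B. is_inverse (a - z *\<^sub>C 1) y)}"

definition positive_in :: "'a::cstar_algebra set \<Rightarrow> 'a \<Rightarrow> bool" where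
  "positive_in B a \<longleftrightarrow> a \<in> B \<and> star a = a \<and> spectrum_in B a \<subseteq> complex_of_real ` {0..}"

definition ge_in :: "'a::cstar_algebra set \<Rightarrow> 'a \<Rightarrow> 'a \<Rightarrow> bool" where
  "ge_in B a b \<longleftrightarrow> positive_in B (a - b)"

section \<open>Operator-valued probability spaces\<close>

locale cstar_probability_space =
  fixes B :: "'a::cstar_algebra set" and F :: "'a \<Rightarrow> 'a"
  assumes subalgebra: "unital_cstar_subalgebra B"
    and F_range: "F a \<in> B"
    and F_add: "F (a + a') = F a + F a'"
    and F_scaleC: "F (z *\<^sub>C a) = z *\<^sub>C F a"
    and F_positive: "positive_in UNIV a \<Longrightarrow> positive_in B (F a)"
    and F_bimodule: "b \<in> B \<Longrightarrow> b' \<in> B \<Longrightarrow> F (b * a * b') = b * F a * b'"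
    and F_one: "F 1 = 1"

definition valued_polynomials :: "'a::cstar_algebra set \<Rightarrow> nat \<Rightarrow> (nat \<Rightarrow> 'a) \<Rightarrow> 'a set" where
  "valued_polynomials B n x = star_subalgebra hull (B \<union> x ` {1..n})"

definition upper_half_plane :: "'a::cstar_algebra set \<Rightarrow> 'a set" where
  "upper_half_plane B =
     {b \<in> B. \<exists>\<epsilon>::real. \<epsilon> > 0 \<and> ge_in B ((- \<i>) *\<^sub>C (b - star b)) (complex_of_real \<epsilon> *\<^sub>C 1)}"

definition cauchy_transform :: "('a::cstar_algebra \<Rightarrow> 'a) \<Rightarrow> 'a \<Rightarrow> 'a \<Rightarrow> 'a" where
  "cauchy_transform F x b = F (elem_inv (b - x))"

section \<open>Matrix amplifications\<close>

text \<open>\<open>M\<^sub>m(\<complex>) \<otimes> \<A>\<close> is the ring of \<open>m \<times> m\<close> matrices over \<open>\<A>\<close>; matrix entries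
  are indexed from 0, so the (1,1) entry of \<open>X\<close> is \<open>X $$ (0,0)\<close>.\<close>

abbreviation matrix_algebra :: "'a::cstar_algebra itself \<Rightarrow> nat \<Rightarrow> 'a mat ring" where
  "matrix_algebra T m \<equiv> ring_mat T m ()"

definition matrices_over :: "nat \<Rightarrow> 'a::cstar_algebra set \<Rightarrow> 'a mat set" where
  "matrices_over m B = {X \<in> carrier_mat m m. elements_mat X \<subseteq> B}"

definition tensor :: "complex mat \<Rightarrow> 'a::cstar_algebra \<Rightarrow> 'a mat" (infix "\<otimes>\<^sub>m" 75) where
  "c \<otimes>\<^sub>m a = map_mat (\<lambda>z. z *\<^sub>C a) c"

definition matrix_cauchy_transform ::
  "nat \<Rightarrow> ('a::cstar_algebra \<Rightarrow> 'a) \<Rightarrow> 'a mat \<Rightarrow> 'a mat \<Rightarrow> 'a mat" where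
  "matrix_cauchy_transform m F X \<beta> =
     map_mat F (inv\<^bsub>matrix_algebra TYPE('a) m\<^esub> (\<beta> - X))"

definition Lambda :: "nat \<Rightarrow> real \<Rightarrow> 'a::cstar_algebra \<Rightarrow> 'a mat" where
  "Lambda m \<epsilon> b = mat_diag m (\<lambda>j. if j = 0 then b else (\<i> * complex_of_real \<epsilon>) *\<^sub>C 1)"

end

theory Submission
  imports Defs "HOL-Analysis.Topology_Euclidean_Space"
begin

text \<open>Every \<open>\<B>\<close>-valued polynomial has a realization \<open>u T\<inverse> v\<close> with an invertible affine pencil \<open>T\<close>,
  because such expressions are closed under the algebra operations and the involution. A
  self-adjoint \<open>P = u T\<inverse> v\<close> then is the Schur complement \<open>- r Q\<inverse> r\<^sup>*\<close> of the self-adjoint affine matrix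
  \<open>L = (0, r; r\<^sup>*, Q)\<close> with \<open>Q = (0, T\<^sup>*; T, 0)\<close> and \<open>r = (u, - v\<^sup>* / 2)\<close>, so that \<open>\<Lambda>\<^sub>0(b) - L\<close> is
  invertible and its inverse has (1,1) entry \<open>(b - P)\<inverse>\<close>; the limit follows by continuity of
  inversion. For \<open>\<epsilon> > 0\<close> the imaginary part of \<open>\<Lambda>\<^sub>\<epsilon>(b) - L\<close> is strictly positive, and Gaussian
  elimination inverts it: every pivot has strictly positive imaginary part, because Schur complements
  inherit the positivity and \<open>v\<^sup>* v\<close> is positive for every \<open>v \<in> \<A>\<close>.\<close>

section \<open>Algebra and inverses in \<open>C\<^sup>*\<close>-algebras\<close>

text \<open>A realization of a product has a block triangular pencil, so \<open>T\<close> has no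
  symmetry even when \<open>P\<close> has; this forces the doubling to \<open>Q\<close>. Both
  \<open>u T' v\<close> and its adjoint then occur in the Schur complement, whence the factor 1/2.
  The diagonal blocks of \<open>Q\<close> vanish, so elimination breaks down at \<epsilon> = 0,
  where the block structure supplies the inverse instead. Conversely, perturbing from \<epsilon> = 0
  would reach only small \<epsilon>, while the resolvent is claimed for all positive ones.

  Matrices are not treated as elements of a C*-algebra: the quadratic forms act on vectors over the
  algebra and take values in it, so positivity is always that of a single element. The price is that
  \<open>star v * v\<close> must be known to be positive for arbitrary \<open>v\<close>. This rests
  on the norm of a self-adjoint element being its spectral radius.\<close>

lemma scaleC_zero_left [simp]: "0 *\<^sub>C (a::'a::cstar_algebra) = 0"
  by (metis add_cancel_left_right scaleC_add_left)

lemma scaleC_zero_right [simp]: "z *\<^sub>C (0::'a::cstar_algebra) = 0"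
  by (metis add_cancel_left_right scaleC_add_right)

lemma scaleC_one [simp]: "1 *\<^sub>C (a::'a::cstar_algebra) = a"
  by (metis of_real_1 scaleR_one scaleR_scaleC)

lemma scaleC_minus_right [simp]: "z *\<^sub>C (- a::'a::cstar_algebra) = - (z *\<^sub>C a)"
  by (metis add.right_inverse add_eq_0_iff scaleC_add_right scaleC_zero_right)

lemma scaleC_minus_left [simp]: "(- z) *\<^sub>C (a::'a::cstar_algebra) = - (z *\<^sub>C a)"
  by (metis add.right_inverse add_eq_0_iff scaleC_add_left scaleC_zero_left)

lemma scaleC_diff_right: "z *\<^sub>C (a - b::'a::cstar_algebra) = z *\<^sub>C a - z *\<^sub>C b"
  by (metis diff_conv_add_uminus scaleC_add_right scaleC_minus_right)

lemma scaleC_diff_left: "(z - w) *\<^sub>C (a::'a::cstar_algebra) = z *\<^sub>C a - w *\<^sub>C a"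
  by (metis diff_conv_add_uminus scaleC_add_left scaleC_minus_left)

lemma scaleC_sum_right: "z *\<^sub>C (\<Sum>i\<in>I. f i) = (\<Sum>i\<in>I. z *\<^sub>C (f i::'a::cstar_algebra))"
  by (induction I rule: infinite_finite_induct) (auto simp: scaleC_add_right)

lemma star_zero [simp]: "star (0::'a::cstar_algebra) = 0"
  by (metis add_cancel_left_right star_add)

lemma star_minus [simp]: "star (- a::'a::cstar_algebra) = - star a"
  by (metis add.right_inverse add_eq_0_iff star_add star_zero)

lemma star_diff: "star (a - b::'a::cstar_algebra) = star a - star b"
  by (metis diff_conv_add_uminus star_add star_minus)

lemma star_one [simp]: "star (1::'a::cstar_algebra) = 1"
  by (metis mult.right_neutral star_mult star_star mult.left_neutral)

lemma star_scaleR [simp]: "star (r *\<^sub>R a::'a::cstar_algebra) = r *\<^sub>R star a"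
  by (simp add: scaleR_scaleC star_scaleC)

lemma star_sum: "star (\<Sum>i\<in>I. f i) = (\<Sum>i\<in>I. star (f i::'a::cstar_algebra))"
  by (induction I rule: infinite_finite_induct) (auto simp: star_add)

lemma star_power: "star (a ^ n::'a::cstar_algebra) = star a ^ n"
  by (induction n) (auto simp: star_mult power_commutes)

lemma norm_star [simp]: "norm (star a::'a::cstar_algebra) = norm a"
proof -
  have "norm a \<le> norm (star a)" for a :: 'a
  proof (cases "a = 0")
    case False
    have "norm a * norm a \<le> norm (star a) * norm a"
      by (metis cstar_identity norm_mult_ineq power2_eq_square)
    with False show ?thesis by simp
  qed simp
  from this[of a] this[of "star a"] show ?thesis by (simp add: star_star)
qed

lemma invertible_elemI:
  assumes "a * y = 1" "y' * a = (1::'a::cstar_algebra)"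
  shows "invertible_elem a"
  using assms unfolding invertible_elem_def is_inverse_def
  by (metis mult.assoc mult.left_neutral mult.right_neutral)

lemma invertible_elemE:
  assumes "invertible_elem (a::'a::cstar_algebra)"
  obtains y where "a * y = 1" "y * a = 1"
  using assms unfolding invertible_elem_def is_inverse_def by blast

lemma elem_inv_eqI:
  assumes "a * y = 1" "y * a = (1::'a::cstar_algebra)"
  shows "elem_inv a = y"
  unfolding elem_inv_def is_inverse_def
  using assms by (intro the_equality) (auto, metis mult.assoc mult.left_neutral mult.right_neutral)

lemma elem_inv:
  assumes "invertible_elem (a::'a::cstar_algebra)"
  shows "a * elem_inv a = 1" "elem_inv a * a = 1"
  using assms elem_inv_eqI by (metis invertible_elemE)+

lemma invertible_elem_mult:
  assumes "invertible_elem a" "invertible_elem (b::'a::cstar_algebra)"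
  shows "invertible_elem (a * b)"
proof -
  obtain y z where "a * y = 1" "y * a = 1" "b * z = 1" "z * b = 1"
    using assms by (auto elim!: invertible_elemE)
  then have "(a * b) * (z * y) = 1" "(z * y) * (a * b) = 1"
    by (metis mult.assoc mult.left_neutral mult.right_neutral)+
  then show ?thesis by (rule invertible_elemI)
qed

lemma invertible_elem_commuting_factor:
  assumes "invertible_elem (a * b)" "a * b = b * (a::'a::cstar_algebra)"
  shows "invertible_elem b"
  using assms by (metis invertible_elemE invertible_elemI mult.assoc)

lemma invertible_elem_scaleC:
  assumes "invertible_elem (a::'a::cstar_algebra)" "z \<noteq> 0"
  shows "invertible_elem (z *\<^sub>C a)"
proof -
  obtain y where "a * y = 1" "y * a = 1" using assms by (auto elim!: invertible_elemE)
  then show ?thesis using assms(2)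
    by (intro invertible_elemI[of _ "inverse z *\<^sub>C y" "inverse z *\<^sub>C y"])
      (auto simp: mult_scaleC_left mult_scaleC_right scaleC_scaleC)
qed

lemma invertible_elem_uminus [simp]: "invertible_elem (- a) \<longleftrightarrow> invertible_elem (a::'a::cstar_algebra)"
  using invertible_elem_scaleC[of a "-1"] invertible_elem_scaleC[of "- a" "-1"] by auto

lemma invertible_elem_one_minus:
  assumes "norm (x::'a::cstar_algebra) < 1"
  shows "invertible_elem (1 - x)"
proof -
  have sm: "summable (\<lambda>n. x ^ n)" by (rule complete_algebra_summable_geometric[OF assms])
  have s: "suminf (\<lambda>n. x ^ n) = 1 + suminf (\<lambda>n. x ^ Suc n)"
    using suminf_split_initial_segment[OF sm, of 1] by simp
  have 1: "suminf (\<lambda>n. x ^ Suc n) = x * suminf (\<lambda>n. x ^ n)"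
    using suminf_mult[OF sm, of x] by simp
  have 2: "suminf (\<lambda>n. x ^ Suc n) = suminf (\<lambda>n. x ^ n) * x"
    using suminf_mult2[OF sm, of x] by (simp add: power_commutes)
  show ?thesis
    by (rule invertible_elemI[of _ "suminf (\<lambda>n. x ^ n)" "suminf (\<lambda>n. x ^ n)"])
      (use s 1 2 in \<open>simp_all add: algebra_simps\<close>)
qed

text \<open>Scaling by \<open>1 / z\<close> reduces this to the Neumann series. It turns positivity
  into invertibility: a positive element lies in a closed ball around a positive scalar whose
  boundary passes through 0, and a positive shift moves it into an open one.\<close>

lemma invertible_elem_norm_diff:
  assumes "norm (z *\<^sub>C 1 - a::'a::cstar_algebra) < cmod z"
  shows "invertible_elem a"
proof -
  have z: "z \<noteq> 0" using assms by auto
  let ?x = "1 - inverse z *\<^sub>C a"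
  have "?x = inverse z *\<^sub>C (z *\<^sub>C 1 - a)"
    using z by (simp add: scaleC_diff_right scaleC_scaleC)
  then have "norm ?x < 1"
    using assms z by (simp only: norm_scaleC norm_inverse) (simp add: divide_simps)
  then have "invertible_elem (inverse z *\<^sub>C a)"
    using invertible_elem_one_minus[of ?x] by simp
  then have "invertible_elem (z *\<^sub>C inverse z *\<^sub>C a)"
    using z by (rule invertible_elem_scaleC)
  then show ?thesis using z by (simp add: scaleC_scaleC)
qed

text \<open>\<open>R - 1 = R * x\<close> bounds \<open>norm (R - 1)\<close> by a quarter of
  \<open>norm R\<close>, hence by a quarter of \<open>norm (R - 1) + 1\<close>; solving gives
  1/3.\<close>

lemma norm_inverse_one_minus_bound:
  assumes "R * (1 - x) = (1::'a::cstar_algebra)" "norm x \<le> 1 / 4"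
  shows "norm (R - 1) \<le> 1 / 3"
proof -
  have e: "R - 1 = R * x" using assms(1) by (simp add: algebra_simps)
  have "norm (R * x) \<le> norm R * (1 / 4)"
    by (rule order_trans[OF norm_mult_ineq]) (use assms(2) in \<open>intro mult_left_mono, auto\<close>)
  moreover have "norm R \<le> norm (R - 1) + 1"
    using norm_triangle_ineq[of "R - 1" 1] by simp
  ultimately show ?thesis using e by simp
qed

text \<open>By the resolvent identity the increment is at most \<open>norm (?R w)\<close> times
  \<open>C * norm (f w - f z)\<close>. Near \<open>z\<close> the second factor is below 1/2, which
  yields the a priori bound \<open>norm (?R w) \<le> 2 * C\<close> and removes the unknown
  inverse.\<close>

lemma continuous_on_elem_inv:
  fixes f :: "complex \<Rightarrow> 'a::cstar_algebra"
  assumes f: "continuous_on S f" and i: "\<And>z. z \<in> S \<Longrightarrow> invertible_elem (f z)"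
  shows "continuous_on S (\<lambda>z. elem_inv (f z))"
  unfolding continuous_on_def
proof
  fix z assume z: "z \<in> S"
  let ?R = "\<lambda>z. elem_inv (f z)"
  define C where "C = norm (?R z)"
  have lim: "((\<lambda>w. f w - f z) \<longlongrightarrow> 0) (at z within S)"
    using f z by (auto simp: continuous_on_def intro: LIM_zero)
  then have limn: "((\<lambda>w. norm (f w - f z)) \<longlongrightarrow> 0) (at z within S)"
    by (rule tendsto_norm_zero)
  have lim2: "((\<lambda>w. C * norm (f w - f z)) \<longlongrightarrow> 0) (at z within S)"
    using tendsto_mult_left[OF limn, of C] by simp
  have inS: "eventually (\<lambda>w. w \<in> S) (at z within S)"
    by (auto simp: eventually_at_filter)
  have small: "eventually (\<lambda>w. C * norm (f w - f z) < 1 / 2) (at z within S)"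
    using order_tendstoD(2)[OF lim2, of "1/2"] by simp
  have "eventually (\<lambda>w. norm (?R w - ?R z) \<le> 2 * C * (C * norm (f w - f z))) (at z within S)"
    using inS small
  proof eventually_elim
    case (elim w)
    have d: "?R w - ?R z = ?R w * (f z - f w) * ?R z"
      using elem_inv[OF i[OF z]] elem_inv[OF i[OF elim(1)]]
      by (simp add: algebra_simps)
    have b: "norm (?R w - ?R z) \<le> norm (?R w) * (C * norm (f w - f z))"
    proof -
      have "norm (?R w - ?R z) \<le> norm (?R w * (f z - f w)) * C"
        unfolding d C_def by (rule norm_mult_ineq)
      also have "\<dots> \<le> norm (?R w) * norm (f z - f w) * C"
        by (intro mult_right_mono norm_mult_ineq) (simp add: C_def)
      finally show ?thesis by (simp add: norm_minus_commute mult_ac)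
    qed
    also have "\<dots> \<le> norm (?R w) * (1 / 2)"
      using elim(2) by (intro mult_left_mono) auto
    finally have "norm (?R w) \<le> 2 * C"
      using norm_triangle_ineq[of "?R w - ?R z" "?R z"] by (simp add: C_def)
    then show ?case using b
      by (smt (verit) C_def mult_right_mono norm_ge_zero mult_nonneg_nonneg)
  qed
  then have "((\<lambda>w. ?R w - ?R z) \<longlongrightarrow> 0) (at z within S)"
  proof (rule Lim_null_comparison)
    show "((\<lambda>w. 2 * C * (C * norm (f w - f z))) \<longlongrightarrow> 0) (at z within S)"
      by (rule tendsto_mult_right_zero[OF lim2])
  qed
  then show "(?R \<longlongrightarrow> ?R z) (at z within S)" by (rule LIM_zero_cancel)
qed

section \<open>Norm and spectrum of self-adjoint elements\<close>

text \<open>The C*-identity for the self-adjoint element \<open>a ^ 2 ^ n\<close> gives one doubling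
  of the exponent. Powers of two are also what repeated averaging over opposite points
  produces.\<close>

lemma norm_selfadjoint_power:
  assumes "star a = (a::'a::cstar_algebra)"
  shows "norm (a ^ (2 ^ n)) = norm a ^ (2 ^ n)"
proof (induction n)
  case (Suc n)
  have "a ^ 2 ^ Suc n = star (a ^ 2 ^ n) * a ^ 2 ^ n"
    using assms by (simp add: star_power mult_2 power_add)
  then have "norm (a ^ 2 ^ Suc n) = (norm (a ^ 2 ^ n))\<^sup>2"
    by (simp add: cstar_identity)
  then show ?case by (simp add: Suc power2_eq_square mult_2 power_add)
qed simp

text \<open>Partial fractions: \<open>1 / (1 - w * w)\<close> is the mean of
  \<open>1 / (1 - w)\<close> and \<open>1 / (1 + w)\<close>.\<close>

lemma inverse_average:
  fixes w :: "'a::cstar_algebra"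
  assumes "X * (1 - w) = 1" "(1 - w) * X = 1" "Y * (1 + w) = 1" "(1 + w) * Y = 1"
  shows "((1/2) *\<^sub>R (X + Y)) * (1 - w * w) = 1" "(1 - w * w) * ((1/2) *\<^sub>R (X + Y)) = 1"
proof -
  have e: "1 - w * w = (1 - w) * (1 + w)" "1 - w * w = (1 + w) * (1 - w)"
    by (simp_all add: algebra_simps)
  have "X * (1 - w * w) = 1 + w" "Y * (1 - w * w) = 1 - w"
    using assms e by (metis mult.assoc mult.left_neutral)+
  then have "(X + Y) * (1 - w * w) = 2 *\<^sub>R 1"
    by (simp add: distrib_right scaleR_2)
  then show "((1/2) *\<^sub>R (X + Y)) * (1 - w * w) = 1"
    by simp
  have "(1 - w * w) * X = 1 + w" "(1 - w * w) * Y = 1 - w"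
    using assms e by (metis mult.assoc mult.right_neutral)+
  then have "(1 - w * w) * (X + Y) = 2 *\<^sub>R 1"
    by (simp add: distrib_left scaleR_2)
  then show "(1 - w * w) * ((1/2) *\<^sub>R (X + Y)) = 1"
    by simp
qed

text \<open>Each induction step averages the inverses at the two square roots \<open>v\<close> and
  \<open>- v\<close> of \<open>u\<close>, so \<open>u\<close> has to range over the whole circle.
  \<open>X\<close> belongs to the unit circle and \<open>Y\<close> to the circle of radius \<rho>;
  the mean of two differences bounded by \<epsilon> is again bounded by \<epsilon>.\<close>

lemma resolvent_squaring:
  fixes a :: "'a::cstar_algebra"
  assumes inv: "\<And>z. cmod z \<le> 1 \<Longrightarrow> invertible_elem (1 - z *\<^sub>C a)"
    and close: "\<And>u. cmod u = 1 \<Longrightarrow>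
      norm (elem_inv (1 - u *\<^sub>C a) - elem_inv (1 - (of_real \<rho> * u) *\<^sub>C a)) \<le> \<epsilon>"
    and \<rho>: "0 \<le> \<rho>" "\<rho> \<le> 1" and u: "cmod u = 1"
  shows "\<exists>X Y. X * (1 - u *\<^sub>C a ^ (2 ^ n)) = 1 \<and> (1 - u *\<^sub>C a ^ (2 ^ n)) * X = 1 \<and>
    Y * (1 - (of_real \<rho> ^ (2 ^ n) * u) *\<^sub>C a ^ (2 ^ n)) = 1 \<and>
    (1 - (of_real \<rho> ^ (2 ^ n) * u) *\<^sub>C a ^ (2 ^ n)) * Y = 1 \<and> norm (X - Y) \<le> \<epsilon>"
  using u
proof (induction n arbitrary: u)
  case 0
  have "cmod (of_real \<rho> * u) \<le> 1" using 0 \<rho> by (simp add: norm_mult)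
  then show ?case
    using elem_inv[OF inv] close 0 by (intro exI) auto
next
  case (Suc n)
  define v where "v = csqrt u"
  have v: "v * v = u" "cmod v = 1"
    using Suc.prems by (simp_all add: v_def flip: power2_eq_square)
  define A where "A = a ^ (2 ^ n)"
  define r :: complex where "r = of_real \<rho> ^ (2 ^ n)"
  have A: "a ^ (2 ^ Suc n) = A * A" by (simp add: A_def mult_2 power_add)
  have r: "of_real \<rho> ^ (2 ^ Suc n) = r * r" by (simp add: r_def mult_2 power_add)
  obtain X Y where XY: "X * (1 - v *\<^sub>C A) = 1" "(1 - v *\<^sub>C A) * X = 1"
    "Y * (1 - (r * v) *\<^sub>C A) = 1" "(1 - (r * v) *\<^sub>C A) * Y = 1" "norm (X - Y) \<le> \<epsilon>"
    using Suc.IH[of v] v unfolding A_def r_def by blast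
  obtain X' Y' where XY': "X' * (1 + v *\<^sub>C A) = 1" "(1 + v *\<^sub>C A) * X' = 1"
    "Y' * (1 + (r * v) *\<^sub>C A) = 1" "(1 + (r * v) *\<^sub>C A) * Y' = 1" "norm (X' - Y') \<le> \<epsilon>"
    using Suc.IH[of "- v"] v unfolding A_def r_def by auto
  have sq: "(v *\<^sub>C A) * (v *\<^sub>C A) = u *\<^sub>C (A * A)"
    "((r * v) *\<^sub>C A) * ((r * v) *\<^sub>C A) = (r * r * u) *\<^sub>C (A * A)"
    using v by (simp_all add: mult_scaleC_left mult_scaleC_right scaleC_scaleC mult_ac flip: v(1))
  let ?X = "(1/2) *\<^sub>R (X + X')" and ?Y = "(1/2) *\<^sub>R (Y + Y')"
  have "?X - ?Y = (1/2) *\<^sub>R ((X - Y) + (X' - Y'))"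
    by (simp add: algebra_simps)
  then have "norm (?X - ?Y) \<le> (1/2) * (norm (X - Y) + norm (X' - Y'))"
    by (simp only: norm_scaleR) (simp add: norm_triangle_ineq)
  then have "norm (?X - ?Y) \<le> \<epsilon>" using XY(5) XY'(5) by simp
  then show ?case
    using inverse_average[OF XY(1,2) XY'(1,2)] inverse_average[OF XY(3,4) XY'(3,4)]
    unfolding sq A r by blast
qed

text \<open>The averages of the resolvent \<open>(1 - z a)\<inverse>\<close> over the \<open>2 ^ n\<close>-th roots of unity are
  \<open>(1 - (z a) ^ (2 ^ n))\<inverse>\<close>; on a slightly smaller circle they tend to 1, which by uniform continuity
  forces \<open>a ^ (2 ^ n)\<close> to be small. This avoids vector-valued complex analysis.\<close>

lemma resolvent_not_defined_on_disc:
  fixes a :: "'a::cstar_algebra"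
  assumes one: "\<And>n. norm (a ^ (2 ^ n)) = 1"
    and inv: "\<And>z. cmod z \<le> 1 \<Longrightarrow> invertible_elem (1 - z *\<^sub>C a)"
  shows False
proof -
  let ?R = "\<lambda>z. elem_inv (1 - z *\<^sub>C a)"
  have "isCont (\<lambda>z. z *\<^sub>C a) z" for z
  proof -
    have "((\<lambda>w. norm (w - z) * norm a) \<longlongrightarrow> 0) (at z)"
      by (intro tendsto_mult_left_zero tendsto_norm_zero LIM_zero tendsto_ident_at)
    then have "((\<lambda>w. w *\<^sub>C a - z *\<^sub>C a) \<longlongrightarrow> 0) (at z)"
      by (rule Lim_null_comparison[rotated]) (simp add: norm_scaleC flip: scaleC_diff_left)
    then show ?thesis unfolding isCont_def by (rule LIM_zero_cancel)
  qed
  then have "continuous_on (cball 0 1) (\<lambda>z. 1 - z *\<^sub>C a)"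
    by (intro continuous_intros continuous_at_imp_continuous_on) auto
  then have "continuous_on (cball 0 1) ?R"
    by (rule continuous_on_elem_inv) (use inv in auto)
  \<comment> \<open>One \<open>d\<close> must serve all points of the circle at once, since the
    roots of unity fill it as \<open>n\<close> grows; compactness of the disc provides it.\<close>
  then have "uniformly_continuous_on (cball 0 1) ?R"
    by (rule compact_uniformly_continuous) simp
  then obtain d where d: "d > 0" "\<And>u v. cmod u \<le> 1 \<Longrightarrow> cmod v \<le> 1 \<Longrightarrow> dist v u < d \<Longrightarrow>
      dist (?R v) (?R u) < 1 / 12"
    unfolding uniformly_continuous_on_def by (metis zero_less_divide_1_iff zero_less_numeral mem_cball_0)
  \<comment> \<open>The maximum covers \<open>d \<ge> 2\<close>; in either case
    \<open>1 - \<rho> < d\<close>.\<close>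
  define \<rho> where "\<rho> = max 0 (1 - d / 2)"
  have \<rho>: "0 \<le> \<rho>" "\<rho> < 1" "1 - \<rho> < d" using d(1) by (auto simp: \<rho>_def)
  have close: "norm (?R u - ?R (of_real \<rho> * u)) \<le> 1 / 12" if u: "cmod u = 1" for u
  proof -
    have "u - of_real \<rho> * u = of_real (1 - \<rho>) * u" by (simp add: algebra_simps)
    then have "dist u (of_real \<rho> * u) < d"
      using \<rho> u by (simp only: dist_norm norm_mult norm_of_real) simp
    moreover have "cmod (of_real \<rho> * u) \<le> 1" using \<rho> u by (simp add: norm_mult)
    ultimately show ?thesis using d(2)[of "of_real \<rho> * u" u] u by (simp add: dist_norm)
  qed
  obtain n where n: "\<rho> ^ n < 1 / 4" using real_arch_pow_inv[of "1/4" \<rho>] \<rho> by auto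
  have "\<rho> ^ (2 ^ n) \<le> \<rho> ^ n" using \<rho> by (intro power_decreasing) auto
  with n have small: "\<rho> ^ (2 ^ n) \<le> 1 / 4" by simp
  define A where "A = a ^ (2 ^ n)"
  define y where "y = (of_real \<rho> ^ (2 ^ n) * 1) *\<^sub>C A"
  obtain X Y where XY: "X * (1 - A) = 1" "Y * (1 - y) = 1" "norm (X - Y) \<le> 1 / 12"
    using resolvent_squaring[of a \<rho> "1/12" 1 n, OF inv close] \<rho> unfolding A_def y_def by auto
  have "norm y \<le> 1 / 4" using small one[of n] \<rho> by (simp add: y_def A_def norm_scaleC norm_power)
  then have "norm (Y - 1) \<le> 1 / 3" by (rule norm_inverse_one_minus_bound[OF XY(2)])
  moreover have "norm (X - 1) \<le> norm (X - Y) + norm (Y - 1)"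
    using norm_triangle_ineq[of "X - Y" "Y - 1"] by simp
  ultimately have X: "norm (X - 1) \<le> 5 / 12" using XY(3) by simp
  \<comment> \<open>As \<open>norm A = 1\<close>, this will give \<open>1 \<le> 5/12 * 2\<close>.
    The constants 1/12 and 1/4 above are chosen so that 1/12 + 1/3 stays below 1/2.\<close>
  have "A = (X - 1) * (1 - A)" using XY(1) by (simp add: algebra_simps)
  then have "norm A \<le> norm (X - 1) * norm (1 - A)" by (metis norm_mult_ineq)
  also have "\<dots> \<le> 5 / 12 * (1 + norm A)"
    using X norm_triangle_ineq4[of 1 A] by (intro mult_mono) auto
  finally show False using one[of n] by (simp add: A_def)
qed

text \<open>This is the bound of the norm by the spectral radius. If it failed, the normalised
  element \<open>b\<close> would have a resolvent on the whole closed unit disc.\<close>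

lemma norm_selfadjoint_less:
  fixes a :: "'a::cstar_algebra"
  assumes sa: "star a = a" and r: "r > 0"
    and inv: "\<And>z. cmod z \<ge> r \<Longrightarrow> invertible_elem (a - z *\<^sub>C 1)"
  shows "norm a < r"
proof (rule ccontr)
  assume "\<not> norm a < r"
  then have c: "norm a \<ge> r" "norm a > 0" using r by auto
  define b where "b = (1 / norm a) *\<^sub>R a"
  have "star b = b" "norm b = 1" using sa c by (auto simp: b_def)
  then have "\<And>n. norm (b ^ (2 ^ n)) = 1" by (simp add: norm_selfadjoint_power)
  then show False
  proof (rule resolvent_not_defined_on_disc)
    fix z :: complex assume z: "cmod z \<le> 1"
    show "invertible_elem (1 - z *\<^sub>C b)"
    proof (cases "z = 0")
      case True
      then show ?thesis using invertible_elem_one_minus[of 0] by simp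
    next
      case False
      \<comment> \<open>\<open>1 - z b\<close> is a non-zero multiple of \<open>a - w\<close>, and
        \<open>cmod z \<le> 1\<close> makes \<open>cmod w\<close> at least \<open>norm a\<close>,
        hence at least \<open>r\<close>.\<close>
      define w where "w = of_real (norm a) / z"
      have "r \<le> norm a / cmod z" using c z False
        by (smt (verit) divide_self_if frac_le norm_eq_zero zero_less_norm_iff le_divide_eq mult_left_le)
      then have "invertible_elem (a - w *\<^sub>C 1)"
        by (intro inv) (simp add: w_def norm_divide)
      then have "invertible_elem (- (z / of_real (norm a)) *\<^sub>C (a - w *\<^sub>C 1))"
        by (rule invertible_elem_scaleC) (use False c in auto)
      moreover have "- (z / of_real (norm a)) *\<^sub>C (a - w *\<^sub>C 1) = 1 - z *\<^sub>C b"
        using False c by (simp add: scaleC_diff_right scaleC_scaleC b_def scaleR_scaleC w_def)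
      ultimately show ?thesis by (simp only:)
    qed
  qed
qed

section \<open>Positivity\<close>

text \<open>The norm condition says that the spectrum of the self-adjoint element is non-negative; in this
  form closure under addition is the triangle inequality.\<close>

definition psd :: "'a::cstar_algebra \<Rightarrow> bool" where
  "psd a \<longleftrightarrow> star a = a \<and> (\<exists>t\<ge>0. norm (t *\<^sub>R 1 - a) \<le> t)"

text \<open>Twice the imaginary part.\<close>

definition im2 :: "'a::cstar_algebra \<Rightarrow> 'a" where
  "im2 a = (- \<i>) *\<^sub>C (a - star a)"

lemma psd_scalar: "r \<ge> 0 \<Longrightarrow> psd (r *\<^sub>R 1)"
  unfolding psd_def by (auto intro!: exI[of _ r])

lemma psd_zero [simp]: "psd 0"
  using psd_scalar[of 0] by simp

lemma psd_add:
  assumes "psd a" "psd b"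
  shows "psd (a + b)"
proof -
  obtain s t where st: "s \<ge> 0" "norm (s *\<^sub>R 1 - a) \<le> s" "t \<ge> 0" "norm (t *\<^sub>R 1 - b) \<le> t"
    using assms unfolding psd_def by blast
  have "norm ((s + t) *\<^sub>R 1 - (a + b)) \<le> norm (s *\<^sub>R 1 - a) + norm (t *\<^sub>R 1 - b)"
    using norm_triangle_ineq[of "s *\<^sub>R 1 - a" "t *\<^sub>R 1 - b"] by (simp add: algebra_simps)
  with st assms show ?thesis
    unfolding psd_def by (auto simp: star_add intro!: exI[of _ "s + t"])
qed

lemma psd_scaleR:
  assumes "psd a" "r \<ge> 0"
  shows "psd (r *\<^sub>R a)"
proof -
  obtain t where t: "t \<ge> 0" "norm (t *\<^sub>R 1 - a) \<le> t"
    using assms unfolding psd_def by blast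
  have "norm ((r * t) *\<^sub>R 1 - r *\<^sub>R a) = r * norm (t *\<^sub>R 1 - a)"
    using assms(2) by (metis abs_of_nonneg norm_scaleR scaleR_right_diff_distrib scaleR_scaleR)
  with t assms show ?thesis
    unfolding psd_def by (auto intro!: exI[of _ "r * t"] mult_left_mono)
qed

lemma invertible_elem_psd:
  assumes "psd (a - d *\<^sub>R 1)" "d > 0"
  shows "invertible_elem a"
proof -
  obtain t where t: "t \<ge> 0" "norm (t *\<^sub>R 1 - (a - d *\<^sub>R 1)) \<le> t"
    using assms unfolding psd_def by blast
  have "of_real (t + d) *\<^sub>C 1 - a = t *\<^sub>R 1 - (a - d *\<^sub>R 1)"
    by (simp add: algebra_simps scaleR_scaleC scaleC_add_left)
  then have "norm (of_real (t + d) *\<^sub>C 1 - a) < cmod (of_real (t + d))"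
    using t assms(2) by (simp only: norm_of_real)
  then show ?thesis by (rule invertible_elem_norm_diff)
qed

text \<open>After rotation by \<open>- \<i>\<close> the hypothesis says that
  \<open>b + star b\<close> is at least \<open>d\<close>. For small \<open>s\<close> the first-order
  gain \<open>s * d\<close> in \<open>norm (1 - s b)\<close> squared beats the second-order term, so
  \<open>s b\<close> is invertible by the Neumann series. Only the norm of \<open>star b * b\<close>
  enters, so the argument can precede its positivity.\<close>

lemma im2_invertible:
  assumes "psd (im2 a - d *\<^sub>R 1)" "d > 0"
  shows "invertible_elem (a::'a::cstar_algebra)"
proof -
  define b where "b = (- \<i>) *\<^sub>C a"
  have b: "im2 a = b + star b"
    by (simp add: b_def im2_def star_scaleC scaleC_diff_right)
  obtain t where t: "t \<ge> 0" "norm (t *\<^sub>R 1 - (im2 a - d *\<^sub>R 1)) \<le> t"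
    using assms unfolding psd_def by blast
  define T where "T = t + d"
  have T: "T > 0" "norm (T *\<^sub>R 1 - (b + star b)) \<le> T - d"
    using t assms(2) b by (auto simp: T_def algebra_simps)
  define N where "N = (norm b)\<^sup>2"
  \<comment> \<open>The first bound keeps the coefficient \<open>1 - s * T\<close> non-negative, the
    second keeps the quadratic term below half of \<open>s * d\<close>; the \<open>+ 1\<close>
    guards against \<open>N = 0\<close>.\<close>
  define s where "s = min (1 / T) (d / (2 * (N + 1)))"
  have N: "N \<ge> 0" by (simp add: N_def)
  have s: "s > 0" "s * T \<le> 1" "s * N \<le> d / 2"
  proof -
    show "s > 0" using T(1) assms(2) N by (simp add: s_def)
    have "s \<le> 1 / T" by (simp add: s_def)
    then show "s * T \<le> 1" using T(1) by (simp add: field_simps)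
    have "s \<le> d / (2 * (N + 1))" by (simp add: s_def)
    then have "s * (N + 1) \<le> d / 2" using N by (simp add: field_simps)
    then show "s * N \<le> d / 2" using \<open>s > 0\<close> by (simp add: algebra_simps)
  qed
  let ?x = "1 - s *\<^sub>R b"
  have "star ?x * ?x = ((1 - s * T) *\<^sub>R 1 + s *\<^sub>R (T *\<^sub>R 1 - (b + star b))) + (s * s) *\<^sub>R (star b * b)"
    by (simp add: star_diff algebra_simps)
  then have "(norm ?x)\<^sup>2 = norm (((1 - s * T) *\<^sub>R 1 + s *\<^sub>R (T *\<^sub>R 1 - (b + star b))) + (s * s) *\<^sub>R (star b * b))"
    by (metis cstar_identity)
  also have "\<dots> \<le> (norm ((1 - s * T) *\<^sub>R (1::'a)) + norm (s *\<^sub>R (T *\<^sub>R 1 - (b + star b)))) + norm ((s * s) *\<^sub>R (star b * b))"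
    by (intro order_trans[OF norm_triangle_ineq] add_right_mono norm_triangle_ineq)
  also have "\<dots> \<le> ((1 - s * T) + s * (T - d)) + s * (s * N)"
    using s T by (intro add_mono) (auto simp: cstar_identity N_def mult_left_mono)
  also have "\<dots> \<le> ((1 - s * T) + s * (T - d)) + s * (d / 2)"
    using s by (intro add_left_mono mult_left_mono) auto
  also have "\<dots> < 1" using s(1) assms(2) by (simp add: algebra_simps)
  finally have "norm ?x < 1" by (simp add: abs_square_less_1)
  from invertible_elem_one_minus[OF this] have "invertible_elem (s *\<^sub>R b)" by simp
  then have "invertible_elem ((\<i> / of_real s) *\<^sub>C (s *\<^sub>R b))"
    by (rule invertible_elem_scaleC) (use s in simp)
  moreover have "(\<i> / of_real s) *\<^sub>C (s *\<^sub>R b) = a"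
    using s(1) by (simp add: b_def scaleR_scaleC scaleC_scaleC)
  ultimately show ?thesis by simp
qed

text \<open>\<open>z - h\<close> has the scalar imaginary part \<open>Im z\<close>; its sign decides
  whether \<open>im2_invertible\<close> applies to \<open>z - h\<close> or to
  \<open>h - z\<close>.\<close>

lemma selfadjoint_real_spectrum:
  assumes "star h = h" "Im z \<noteq> 0"
  shows "invertible_elem (h - z *\<^sub>C (1::'a::cstar_algebra))"
proof -
  have z: "z - cnj z = of_real (2 * Im z) * \<i>" by (simp add: complex_eq_iff)
  have "(z - cnj z) *\<^sub>C (1::'a) = z *\<^sub>C 1 - cnj z *\<^sub>C 1" by (rule scaleC_diff_left)
  then have "im2 (z *\<^sub>C 1 - h) = (- \<i>) *\<^sub>C (z - cnj z) *\<^sub>C 1"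
    using assms(1) by (simp add: im2_def star_diff star_scaleC)
  also have "\<dots> = (2 * Im z) *\<^sub>R 1"
    unfolding z scaleR_scaleC scaleC_scaleC
    by (rule arg_cong[where f = "\<lambda>z. z *\<^sub>C 1"]) (simp add: complex_eq_iff)
  finally have e: "im2 (z *\<^sub>C 1 - h) = (2 * Im z) *\<^sub>R 1" .
  moreover have "im2 (- a) = - im2 a" for a :: 'a
    by (simp add: im2_def algebra_simps flip: scaleC_minus_right)
  ultimately have e': "im2 (h - z *\<^sub>C 1) = (- 2 * Im z) *\<^sub>R 1"
    by (metis minus_diff_eq mult_minus_left scaleR_minus_left)
  show ?thesis
  proof (cases "Im z > 0")
    case True
    then have "invertible_elem (z *\<^sub>C 1 - h)"
      by (intro im2_invertible[of _ "2 * Im z"]) (auto simp: e)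
    then show ?thesis using invertible_elem_uminus[of "z *\<^sub>C 1 - h"] by simp
  next
    case False
    then show ?thesis using assms(2)
      by (intro im2_invertible[of _ "- 2 * Im z"]) (auto simp: e')
  qed
qed

text \<open>The spectrum of \<open>a\<close> lies between 0 and \<open>norm a\<close>, so that of
  \<open>t - a\<close> lies between 0 and \<open>t\<close>, and for a self-adjoint element the
  spectral radius bounds the norm. The slack \<open>e\<close> provides the strict
  inequality.\<close>

lemma norm_diff_le_if_spectrum:
  fixes a :: "'a::cstar_algebra"
  assumes sa: "star a = a" and t: "norm a \<le> t"
    and inv: "\<And>z. z \<notin> complex_of_real ` {0..} \<Longrightarrow> invertible_elem (a - z *\<^sub>C 1)"
  shows "norm (t *\<^sub>R 1 - a) \<le> t"
proof (rule field_le_epsilon)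
  fix e :: real assume e: "e > 0"
  have t0: "t \<ge> 0" using t norm_ge_zero order_trans by blast
  have "norm (t *\<^sub>R 1 - a) < t + e"
  proof (rule norm_selfadjoint_less)
    show "star (t *\<^sub>R 1 - a) = t *\<^sub>R 1 - a" using sa by (simp add: star_diff)
    show "t + e > 0" using t0 e by simp
    fix z assume z: "t + e \<le> cmod z"
    define w where "w = of_real t - z"
    have "invertible_elem (a - w *\<^sub>C 1)"
    proof (cases "w \<in> complex_of_real ` {0..}")
      case True
      then obtain x where x: "w = of_real x" "x \<ge> 0" by auto
      have "z = of_real t - w" by (simp add: w_def)
      then have "z = of_real (t - x)" by (simp add: x)
      with z have "\<bar>t - x\<bar> \<ge> t + e" by (metis norm_of_real)
      then have "x > t" using x t0 e by linarith
      then have "norm ((- w) *\<^sub>C 1 - (a - w *\<^sub>C 1)) < cmod (- w)"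
        using x t by (simp add: norm_minus_cancel)
      then show ?thesis by (rule invertible_elem_norm_diff)
    qed (rule inv)
    then have "invertible_elem (- (a - w *\<^sub>C 1))" by (simp only: invertible_elem_uminus)
    moreover have "- (a - w *\<^sub>C 1) = t *\<^sub>R 1 - a - z *\<^sub>C 1"
      by (simp add: w_def scaleC_diff_left scaleR_scaleC)
    ultimately show "invertible_elem (t *\<^sub>R 1 - a - z *\<^sub>C 1)" by (simp only:)
  qed
  then show "norm (t *\<^sub>R 1 - a) \<le> t + e" by simp
qed

lemma psdI_spectrum:
  fixes a :: "'a::cstar_algebra"
  assumes "star a = a" "\<And>z. z \<notin> complex_of_real ` {0..} \<Longrightarrow> invertible_elem (a - z *\<^sub>C 1)"
  shows "psd a"
  using norm_diff_le_if_spectrum[OF assms(1) order_refl assms(2)] assms(1)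
  unfolding psd_def by (auto intro!: exI[of _ "norm a"])

text \<open>Factor \<open>y * y - z\<close> as \<open>(y - w) * (y + w)\<close>: a square root of a
  number off the non-negative half-line is never real.\<close>

lemma psd_square:
  assumes "star y = (y::'a::cstar_algebra)"
  shows "psd (y * y)"
proof (rule psdI_spectrum)
  show "star (y * y) = y * y" using assms by (simp add: star_mult)
  fix z :: complex assume z: "z \<notin> complex_of_real ` {0..}"
  define w where "w = csqrt z"
  have w: "w * w = z" by (simp add: w_def flip: power2_eq_square)
  have "Im w \<noteq> 0"
  proof
    assume "Im w = 0"
    then have "z = of_real (Re w * Re w)" using w by (auto simp: complex_eq_iff)
    with z show False by (metis atLeast_iff image_eqI zero_le_square)
  qed
  then have "invertible_elem ((y - w *\<^sub>C 1) * (y - (- w) *\<^sub>C 1))"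
    by (intro invertible_elem_mult selfadjoint_real_spectrum assms) auto
  moreover have "(y - w *\<^sub>C 1) * (y - (- w) *\<^sub>C 1) = y * y - z *\<^sub>C 1"
    by (simp add: algebra_simps mult_scaleC_left mult_scaleC_right scaleC_diff_right scaleC_scaleC w)
  ultimately show "invertible_elem (y * y - z *\<^sub>C 1)" by simp
qed

text \<open>Expanding the inverse formally as a geometric series suggests
  \<open>1 - y * c * x\<close>. This exchange will turn a statement on \<open>w * star w\<close>
  into one on \<open>star w * w\<close>.\<close>

lemma invertible_elem_one_plus_swap:
  assumes "invertible_elem (1 + x * y)"
  shows "invertible_elem (1 + y * (x::'a::cstar_algebra))"
proof -
  obtain c where c: "(1 + x * y) * c = 1" "c * (1 + x * y) = 1"
    using assms by (auto elim!: invertible_elemE)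
  have c': "x * (y * c) = 1 - c" "c * (x * y) = 1 - c" using c by (simp_all add: algebra_simps)
  have "(1 + y * x) * (1 - y * c * x) = 1 + y * x - y * (c + x * (y * c)) * x"
    by (simp add: algebra_simps)
  moreover have "(1 - y * c * x) * (1 + y * x) = 1 + y * x - y * (c + c * (x * y)) * x"
    by (simp add: algebra_simps)
  ultimately show ?thesis
    by (intro invertible_elemI[of _ "1 - y * c * x" "1 - y * c * x"]) (auto simp: c')
qed

text \<open>Let \<open>a = v\<^sup>* v\<close> and \<open>w = v f\<close> with \<open>f = (a + t)\<inverse>\<close>. The function \<open>4 t s / (s + t)\<^sup>2 = 1 - ((s - t) / (s + t))\<^sup>2\<close>
  bounds \<open>4 t w\<^sup>* w\<close> above by 1, and \<open>w\<^sup>* w + w w\<^sup>* = 2 ((Re w)\<^sup>2 + (Im w)\<^sup>2)\<close> then bounds \<open>4 t w w\<^sup>*\<close> below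
  by \<open>-1\<close>. So \<open>4 t w\<^sup>* w + 8\<close> is invertible, and it is \<open>8 (a + t)\<^sup>-\<^sup>2 (a + 2 t) (a + t / 2)\<close>.\<close>

lemma star_mult_self_plus_half:
  fixes v :: "'a::cstar_algebra"
  assumes t: "t > 0" and inv: "invertible_elem (star v * v + t *\<^sub>R 1)"
  shows "invertible_elem (star v * v + (t / 2) *\<^sub>R 1)"
proof -
  define a where "a = star v * v"
  obtain f where f: "(a + t *\<^sub>R 1) * f = 1" "f * (a + t *\<^sub>R 1) = 1"
    using inv by (auto elim!: invertible_elemE simp: a_def)
  have sa: "star a = a" by (simp add: a_def star_mult star_star)
  have af: "a * f = 1 - t *\<^sub>R f" "f * a = 1 - t *\<^sub>R f"
    using f by (simp_all add: algebra_simps)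
  have "star f * (a + t *\<^sub>R 1) = star ((a + t *\<^sub>R 1) * f)"
    by (simp add: star_mult star_add sa)
  then have sf: "star f = f"
    by (metis f(1) mult.assoc mult.left_neutral mult.right_neutral star_one)
  define w where "w = v * f"
  have ww: "star w * w = f - t *\<^sub>R (f * f)"
  proof -
    have "star w * w = f * a * f" by (simp add: w_def star_mult sf a_def mult.assoc)
    then show ?thesis by (simp add: af algebra_simps)
  qed
  \<comment> \<open>\<open>y\<close> is \<open>(a - t) * f\<close>, the function
    \<open>(s - t) / (s + t)\<close> evaluated at \<open>a\<close>.\<close>
  define y where "y = 1 - (2 * t) *\<^sub>R f"
  have sy: "star y = y" by (simp add: y_def star_diff sf)
  have y: "(4 * t) *\<^sub>R (star w * w) = 1 - y * y"
    by (simp add: ww y_def algebra_simps flip: scaleR_add_left)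
  define g where "g = w + star w"
  define h where "h = \<i> *\<^sub>C (w - star w)"
  have gh: "star g = g" "star h = h"
    by (simp_all add: g_def h_def star_add star_star star_diff star_scaleC scaleC_diff_right)
  have "h * h = - ((w - star w) * (w - star w))"
    by (simp add: h_def mult_scaleC_left mult_scaleC_right scaleC_scaleC)
  then have "g * g + h * h = 2 *\<^sub>R (star w * w + w * star w)"
    by (simp add: g_def algebra_simps scaleR_2)
  then have "(4 * t) *\<^sub>R (w * star w) + 1 = (2 * t) *\<^sub>R (g * g + h * h) + y * y"
    using y by (simp add: algebra_simps)
  moreover have "psd ((2 * t) *\<^sub>R (g * g + h * h) + y * y)"
    using t by (intro psd_add psd_scaleR psd_square gh sy) auto
  \<comment> \<open>Any constant above 1 would leave a positive margin. With 8 the quadratic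
    obtained below is \<open>a * a + (5/2) t a + t * t\<close>, whose roots are
    \<open>- t / 2\<close> and \<open>- 2 t\<close>.\<close>
  ultimately have "psd ((4 * t) *\<^sub>R (w * star w) + 8 *\<^sub>R 1 - 7 *\<^sub>R 1)"
    by (simp flip: add_diff_eq scaleR_diff_left)
  then have "invertible_elem ((4 * t) *\<^sub>R (w * star w) + 8 *\<^sub>R 1)"
    by (rule invertible_elem_psd) simp
  then have "invertible_elem (of_real (1 / 8) *\<^sub>C ((4 * t) *\<^sub>R (w * star w) + 8 *\<^sub>R 1))"
    by (rule invertible_elem_scaleC) simp
  moreover have "(1 / 8) *\<^sub>R ((4 * t) *\<^sub>R (w * star w) + 8 *\<^sub>R 1) = 1 + ((t / 2) *\<^sub>R w) * star w"
    by (simp add: algebra_simps)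
  ultimately have "invertible_elem (1 + ((t / 2) *\<^sub>R w) * star w)"
    by (simp only: flip: scaleR_scaleC)
  then have "invertible_elem (1 + star w * ((t / 2) *\<^sub>R w))"
    by (rule invertible_elem_one_plus_swap)
  then have "invertible_elem ((a + t *\<^sub>R 1) * (1 + (t / 2) *\<^sub>R (star w * w)) * (a + t *\<^sub>R 1))"
    using inv by (intro invertible_elem_mult) (auto simp: a_def)
  moreover have "(a + t *\<^sub>R 1) * (1 + (t / 2) *\<^sub>R (star w * w)) * (a + t *\<^sub>R 1) =
    (a + (2 * t) *\<^sub>R 1) * (a + (t / 2) *\<^sub>R 1)"
  proof -
    have "(a + t *\<^sub>R 1) * (star w * w) * (a + t *\<^sub>R 1)
        = ((a + t *\<^sub>R 1) * f) * a * (f * (a + t *\<^sub>R 1))"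
      by (simp add: w_def star_mult sf a_def mult.assoc)
    then have "(a + t *\<^sub>R 1) * (star w * w) * (a + t *\<^sub>R 1) = a" using f by simp
    then have "(a + t *\<^sub>R 1) * (1 + (t / 2) *\<^sub>R (star w * w)) * (a + t *\<^sub>R 1) =
        (a + t *\<^sub>R 1) * (a + t *\<^sub>R 1) + (t / 2) *\<^sub>R a"
    proof -
      have "c * (1 + s *\<^sub>R p) * c = c * c + s *\<^sub>R (c * p * c)" for c p :: 'a and s
        by (simp add: distrib_left distrib_right)
      then show ?thesis
        using \<open>(a + t *\<^sub>R 1) * (star w * w) * (a + t *\<^sub>R 1) = a\<close> by simp
    qed
    also have "\<dots> = (a + (2 * t) *\<^sub>R 1) * (a + (t / 2) *\<^sub>R 1)"
    proof -
      have e: "(t * 2) *\<^sub>R a = t *\<^sub>R a + t *\<^sub>R a"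
        by (metis mult.commute mult_2 scaleR_add_left)
      show ?thesis by (simp add: algebra_simps e)
    qed
    finally show ?thesis .
  qed
  ultimately have "invertible_elem ((a + (2 * t) *\<^sub>R 1) * (a + (t / 2) *\<^sub>R 1))" by (simp only:)
  then show ?thesis unfolding a_def[symmetric]
    by (rule invertible_elem_commuting_factor) (simp add: algebra_simps)
qed

text \<open>Negative reals are excluded from the spectrum by descent: a shift beyond the norm is
  invertible, and halving the shift preserves this, so starting from \<open>2 ^ n * t\<close> one
  arrives at the given \<open>t\<close>.\<close>

lemma psd_star_mult_self: "psd (star v * (v::'a::cstar_algebra))"
proof (rule psdI_spectrum)
  let ?a = "star v * v"
  show sa: "star ?a = ?a" by (simp add: star_mult star_star)
  have pos: "invertible_elem (?a + t *\<^sub>R 1)" if t: "t > 0" for t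
  proof -
    obtain n :: nat where "norm ?a / t < 2 ^ n" using real_arch_pow[of 2 "norm ?a / t"] by auto
    then have n: "norm ?a < 2 ^ n * t" using t by (simp add: field_simps)
    have "invertible_elem (?a + (2 ^ n * t / 2 ^ k) *\<^sub>R 1)" for k
    proof (induction k)
      case 0
      have "norm (of_real (2 ^ n * t) *\<^sub>C 1 - (?a + (2 ^ n * t) *\<^sub>R 1)) < cmod (of_real (2 ^ n * t))"
        using n t by (simp add: norm_minus_cancel scaleR_scaleC norm_mult norm_power)
      then show ?case by (simp add: invertible_elem_norm_diff)
    next
      case (Suc k)
      then show ?case
        using star_mult_self_plus_half[of "2 ^ n * t / 2 ^ k" v] t by (simp add: field_simps)
    qed
    from this[of n] show ?thesis by simp
  qed
  fix z :: complex assume z: "z \<notin> complex_of_real ` {0..}"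
  show "invertible_elem (?a - z *\<^sub>C 1)"
  proof (cases "Im z = 0")
    case True
    then have zr: "z = of_real (Re z)" by (simp add: complex_eq_iff)
    then have "- Re z > 0" using z by (metis atLeast_iff image_eqI neg_0_less_iff_less not_less)
    from pos[OF this] show ?thesis by (subst zr) (simp flip: scaleR_scaleC)
  qed (simp add: selfadjoint_real_spectrum sa)
qed

text \<open>An inverse found in \<open>B\<close> is an inverse in the whole algebra, so enlarging
  the algebra can only shrink the spectrum.\<close>

lemma psd_if_positive_in:
  assumes "positive_in B a"
  shows "psd (a::'a::cstar_algebra)"
proof (rule psdI_spectrum)
  show "star a = a" using assms by (simp add: positive_in_def)
  fix z :: complex assume "z \<notin> complex_of_real ` {0..}"
  then show "invertible_elem (a - z *\<^sub>C 1)"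
    using assms unfolding positive_in_def spectrum_in_def invertible_elem_def by blast
qed

text \<open>This supplies elements to which \<open>F_positive\<close> applies. For negative real
  \<open>z\<close>, the element \<open>c - a - z\<close> stays within distance \<open>c\<close> of
  the larger scalar \<open>c - z\<close>.\<close>

lemma positive_in_UNIV_norm_diff:
  assumes sa: "star a = (a::'a::cstar_algebra)" and c: "norm a \<le> c"
  shows "positive_in UNIV (c *\<^sub>R 1 - a)"
proof -
  have "invertible_elem (c *\<^sub>R 1 - a - z *\<^sub>C 1)" if z: "z \<notin> complex_of_real ` {0..}" for z
  proof (cases "Im z = 0")
    case True
    then have zr: "z = of_real (Re z)" by (simp add: complex_eq_iff)
    then have "Re z < 0" using z by (metis atLeast_iff image_eqI not_less)
    then have "norm (of_real (c - Re z) *\<^sub>C 1 - (c *\<^sub>R 1 - a - z *\<^sub>C 1)) < cmod (of_real (c - Re z))"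
      using c norm_ge_zero[of a]
      by (subst zr) (simp only: norm_of_real, simp add: scaleC_diff_left scaleR_scaleC)
    then show ?thesis by (rule invertible_elem_norm_diff)
  qed (simp add: selfadjoint_real_spectrum star_diff sa)
  then show ?thesis
    unfolding positive_in_def spectrum_in_def invertible_elem_def
    using sa by (auto simp: star_diff)
qed

text \<open>A real \<open>x\<close> with modulus beyond \<open>c\<close> makes \<open>x - h\<close>
  or \<open>h - x\<close> strictly positive, hence invertible; so the spectral radius of
  \<open>h\<close> is at most \<open>c\<close>.\<close>

lemma norm_le_if_psd:
  assumes "psd (c *\<^sub>R 1 - h)" "psd (c *\<^sub>R 1 + h)" and c: "c \<ge> 0"
  shows "norm (h::'a::cstar_algebra) \<le> c"
proof (rule field_le_epsilon)
  fix e :: real assume e: "e > 0"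
  have sa: "star h = h" using assms(1) by (simp add: psd_def star_diff)
  have "norm h < c + e"
  proof (rule norm_selfadjoint_less)
    fix z assume z: "c + e \<le> cmod z"
    show "invertible_elem (h - z *\<^sub>C 1)"
    proof (cases "Im z = 0")
      case True
      define x where "x = Re z"
      have zr: "z = of_real x" using True by (simp add: complex_eq_iff x_def)
      then have h: "h - z *\<^sub>C 1 = h - x *\<^sub>R 1" by (simp add: scaleR_scaleC)
      from z zr have "c + e \<le> \<bar>x\<bar>" by simp
      then consider "x > c" | "- x > c" using e by linarith
      then show ?thesis
      proof cases
        case 1
        have "psd ((x *\<^sub>R 1 - h) - (x - c) *\<^sub>R 1)"
          using assms(1) by (simp add: algebra_simps)
        then have "invertible_elem (- (h - x *\<^sub>R 1))"
          using invertible_elem_psd[of "x *\<^sub>R 1 - h" "x - c"] 1 by simp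
        then show ?thesis unfolding h by (simp only: invertible_elem_uminus)
      next
        case 2
        have "psd ((h - x *\<^sub>R 1) - (- x - c) *\<^sub>R 1)"
          using assms(2) by (simp add: algebra_simps)
        then show ?thesis unfolding h by (rule invertible_elem_psd) (use 2 in simp)
      qed
    qed (simp add: selfadjoint_real_spectrum sa)
  qed (use sa c e in auto)
  then show "norm h \<le> c + e" by simp
qed

section \<open>Boundedness and continuity of the conditional expectation\<close>

context cstar_probability_space
begin

lemma F_scaleR: "F (r *\<^sub>R a) = r *\<^sub>R F a"
  by (simp add: scaleR_scaleC F_scaleC)

lemma F_minus: "F (- a) = - F a"
  using F_scaleC[of "-1" a] by simp

lemma F_diff: "F (a - b) = F a - F b"
  using F_add[of a "- b"] by (simp add: F_minus)

lemma norm_F_selfadjoint: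
  assumes "star a = a"
  shows "norm (F a) \<le> norm a"
proof (rule norm_le_if_psd)
  have "psd (norm a *\<^sub>R 1 - F b)" if "star b = b" "norm b = norm a" for b
    using psd_if_positive_in[OF F_positive[OF positive_in_UNIV_norm_diff[OF that(1) order_refl]]] that(2)
    by (simp add: F_diff F_scaleR F_one)
  from this[of a] this[of "- a"] assms
  show "psd (norm a *\<^sub>R 1 - F a)" "psd (norm a *\<^sub>R 1 + F a)" by (simp_all add: F_minus)
qed simp

text \<open>Split into self-adjoint parts by \<open>2 a = g - \<i> h\<close>. The constant 2 is
  harmless, as only continuity is wanted.\<close>

lemma norm_F_le: "norm (F a) \<le> 2 * norm a"
proof -
  define g where "g = a + star a"
  define h where "h = \<i> *\<^sub>C (a - star a)"
  have "star g = g" "star h = h"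
    by (simp_all add: g_def h_def star_add star_star star_diff star_scaleC scaleC_diff_right)
  then have 1: "norm (F g) \<le> norm g" "norm (F h) \<le> norm h" by (auto intro: norm_F_selfadjoint)
  have 2: "norm g \<le> 2 * norm a" "norm h \<le> 2 * norm a"
    using norm_triangle_ineq[of a "star a"] norm_triangle_ineq4[of a "star a"]
    by (simp_all add: g_def h_def norm_scaleC)
  have "2 *\<^sub>R a = g - \<i> *\<^sub>C h"
    by (simp add: g_def h_def scaleC_scaleC scaleR_2)
  then have "2 *\<^sub>R F a = F g - \<i> *\<^sub>C F h"
    by (metis F_diff F_scaleC F_scaleR)
  then have "norm (2 *\<^sub>R F a) \<le> norm (F g) + norm (\<i> *\<^sub>C F h)"
    by (simp only: norm_triangle_ineq4)
  with 1 2 show ?thesis by (simp add: norm_scaleC)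
qed

lemma tendsto_F: "(f \<longlongrightarrow> a) G \<Longrightarrow> ((\<lambda>x. F (f x)) \<longlongrightarrow> F a) G"
proof -
  assume "(f \<longlongrightarrow> a) G"
  then have "((\<lambda>x. 2 * norm (f x - a)) \<longlongrightarrow> 0) G"
    by (intro tendsto_mult_right_zero tendsto_norm_zero LIM_zero)
  then have "((\<lambda>x. F (f x) - F a) \<longlongrightarrow> 0) G"
    by (rule Lim_null_comparison[rotated]) (simp add: norm_F_le flip: F_diff)
  then show ?thesis by (rule LIM_zero_cancel)
qed

end

section \<open>Matrices with positive imaginary part\<close>

text \<open>Both products are demanded because over a non-commutative ring a one-sided inverse of a
  square matrix need not be two-sided.\<close>

definition mutually_inverse :: "nat \<Rightarrow> 'a::ring_1 mat \<Rightarrow> 'a mat \<Rightarrow> bool" where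
  "mutually_inverse n A A' \<longleftrightarrow>
     A \<in> carrier_mat n n \<and> A' \<in> carrier_mat n n \<and> A * A' = 1\<^sub>m n \<and> A' * A = 1\<^sub>m n"

text \<open>The library versions of the next laws have dimension variables that rewriting cannot
  instantiate.\<close>

lemma mat_mult_assoc_dim:
  fixes A :: "'a::ring_1 mat"
  assumes "dim_col A = dim_row B" "dim_col B = dim_row C"
  shows "A * B * C = A * (B * C)"
  by (rule assoc_mult_mat[of _ "dim_row A" "dim_col A" _ "dim_col B" _ "dim_col C"])
    (use assms in auto)

lemma mat_mult_add_dim:
  fixes A :: "'a::ring_1 mat"
  assumes "dim_col A = dim_row B" "dim_row B = dim_row C" "dim_col B = dim_col C"
  shows "A * (B + C) = A * B + A * C"
  by (rule mult_add_distrib_mat[of _ "dim_row A" "dim_col A" _ "dim_col B"])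
    (use assms in auto)

lemma mat_add_mult_dim:
  fixes A :: "'a::ring_1 mat"
  assumes "dim_row A = dim_row B" "dim_col A = dim_col B" "dim_col A = dim_row C"
  shows "(A + B) * C = A * C + B * C"
  by (rule add_mult_distrib_mat[of _ "dim_row A" "dim_col A" _ _ "dim_col C"])
    (use assms in auto)

lemma mat_mult_uminus_dim:
  fixes A :: "'a::ring_1 mat"
  assumes "dim_col A = dim_row B"
  shows "A * (- B) = - (A * B)" "(- A) * B = - (A * B)"
  using assms by (auto intro!: eq_matI simp: scalar_prod_def sum_negf)

text \<open>The matrix is \<open>(1, X; 0, 1) diag(S, D) (1, 0; Y, 1)\<close>, inverted factor by
  factor. \<open>S\<close> is its Schur complement, and the inverse has the corner
  \<open>S'\<close>, which is what the final limit reads off.\<close>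

lemma mutually_inverse_schur:
  fixes S :: "'a::ring_1 mat"
  assumes S: "mutually_inverse n S S'" and D: "mutually_inverse m D D'"
    and X: "X \<in> carrier_mat n m" and Y: "Y \<in> carrier_mat m n"
  shows "mutually_inverse (n + m)
    (four_block_mat (S + X * (D * Y)) (X * D) (D * Y) D)
    (four_block_mat S' (- (S' * X)) (- (Y * S')) (D' + Y * (S' * X)))"
proof -
  have c: "S \<in> carrier_mat n n" "S' \<in> carrier_mat n n" "D \<in> carrier_mat m m" "D' \<in> carrier_mat m m"
    and i: "S * S' = 1\<^sub>m n" "S' * S = 1\<^sub>m n" "D * D' = 1\<^sub>m m" "D' * D = 1\<^sub>m m"
    using S D by (auto simp: mutually_inverse_def)
  have d: "dim_row S = n" "dim_col S = n" "dim_row S' = n" "dim_col S' = n"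
    "dim_row D = m" "dim_col D = m" "dim_row D' = m" "dim_col D' = m"
    "dim_row X = n" "dim_col X = m" "dim_row Y = m" "dim_col Y = n"
    using c X Y by auto
  have ia: "S * (S' * Z) = Z" "S' * (S * Z) = Z" if "dim_row Z = n" for Z
    using i that d by (simp_all flip: mat_mult_assoc_dim add: left_mult_one_mat')
  have ib: "D * (D' * Z) = Z" "D' * (D * Z) = Z" if "dim_row Z = m" for Z
    using i that d by (simp_all flip: mat_mult_assoc_dim add: left_mult_one_mat')
  let ?H = "four_block_mat (S + X * (D * Y)) (X * D) (D * Y) D"
  let ?G = "four_block_mat S' (- (S' * X)) (- (Y * S')) (D' + Y * (S' * X))"
  note laws = mat_mult_assoc_dim mat_mult_add_dim mat_add_mult_dim mat_mult_uminus_dim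
  have HG: "?H * ?G = four_block_mat (1\<^sub>m n) (0\<^sub>m n m) (0\<^sub>m m n) (1\<^sub>m m)"
    by (subst mult_four_block_mat[of _ n n _ m _ m _ _ n _ m])
      (use c X Y in \<open>auto intro!: cong_four_block_mat eq_matI simp: laws d i ia ib
        simp del: index_mult_mat(1) assoc_mult_mat\<close>)
  have GH: "?G * ?H = four_block_mat (1\<^sub>m n) (0\<^sub>m n m) (0\<^sub>m m n) (1\<^sub>m m)"
    by (subst mult_four_block_mat[of _ n n _ m _ m _ _ n _ m])
      (use c X Y in \<open>auto intro!: cong_four_block_mat eq_matI simp: laws d i ia ib
        simp del: index_mult_mat(1) assoc_mult_mat\<close>)
  show ?thesis using HG GH c X Y by (auto simp: mutually_inverse_def)
qed

section \<open>Algebra-valued quadratic forms and Gaussian elimination\<close>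

definition quad_form :: "nat \<Rightarrow> (nat \<Rightarrow> nat \<Rightarrow> 'a::cstar_algebra) \<Rightarrow> (nat \<Rightarrow> 'a) \<Rightarrow> 'a" where
  "quad_form m H \<xi> = (\<Sum>i<m. \<Sum>j<m. star (\<xi> i) * H i j * \<xi> j)"

text \<open>Coordinate 0 is kept apart: there \<open>b\<close> sits, whose imaginary part is an
  element \<open>k\<close>, while the other diagonal entries contribute a scalar \<open>e\<close>.
  Vectors need entries in the algebra because passing to a Schur complement extends them by such an
  entry.\<close>

definition dissipative :: "nat \<Rightarrow> 'a::cstar_algebra \<Rightarrow> real \<Rightarrow> (nat \<Rightarrow> nat \<Rightarrow> 'a) \<Rightarrow> bool" where
  "dissipative m k e H \<longleftrightarrow> (\<forall>\<xi>. psd (im2 (quad_form m H \<xi>) - star (\<xi> 0) * k * \<xi> 0 -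
     e *\<^sub>R (\<Sum>j\<in>{1..<m}. star (\<xi> j) * \<xi> j)))"

text \<open>The row of index \<open>m\<close> is gathered in one bracket, since choosing \<xi> at
  \<open>m\<close> to cancel it produces the Schur complement.\<close>

lemma quad_form_Suc:
  "quad_form (Suc m) H \<xi> = quad_form m H \<xi> + (\<Sum>i<m. star (\<xi> i) * H i m) * \<xi> m +
     star (\<xi> m) * ((\<Sum>j<m. H m j * \<xi> j) + H m m * \<xi> m)"
  by (simp add: quad_form_def sum.distrib sum_distrib_left sum_distrib_right algebra_simps)

lemma quad_form_cong: "(\<And>i. i < m \<Longrightarrow> \<xi> i = \<eta> i) \<Longrightarrow> quad_form m H \<xi> = quad_form m H \<eta>"
  by (simp add: quad_form_def)

lemma dissipative_pivot:
  assumes "dissipative (Suc m) k e H" "m > 0" "e > 0"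
  shows "invertible_elem (H m m)"
proof -
  have q: "quad_form (Suc m) H (\<lambda>j. if j = m then 1 else 0) = H m m"
    by (simp add: quad_form_Suc quad_form_def)
  have "(\<Sum>j\<in>{1..<Suc m}. star (if j = m then 1 else 0) * (if j = m then 1 else 0)) = (1::'a)"
    using assms(2) by (simp add: sum.delta if_distrib cong: if_cong)
  then have "psd (im2 (H m m) - e *\<^sub>R 1)"
    using assms(1)[unfolded dissipative_def, rule_format, of "\<lambda>j. if j = m then 1 else 0"] q assms(2)
    by simp
  then show ?thesis by (rule im2_invertible) (fact assms(3))
qed

text \<open>The form of the Schur complement at \<open>\<xi>\<close> is the form of \<open>H\<close> at \<open>(\<xi>, \<eta>)\<close> with
  \<open>\<eta> = - g \<Sum>\<^sub>j H\<^sub>m\<^sub>j \<xi>\<^sub>j\<close>.\<close>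

lemma dissipative_schur:
  assumes H: "dissipative (Suc m) k e H" and m: "m > 0" and e: "e > 0"
    and g: "H m m * g = 1"
  shows "dissipative m k e (\<lambda>i j. H i j - H i m * g * H m j)"
  unfolding dissipative_def
proof
  fix \<xi> :: "nat \<Rightarrow> 'a"
  let ?H = "\<lambda>i j. H i j - H i m * g * H m j"
  define r where "r = (\<Sum>j<m. H m j * \<xi> j)"
  define \<eta> where "\<eta> = \<xi>(m := - g * r)"
  have "H m m * (g * r) = r" by (simp add: g flip: mult.assoc)
  then have z: "(\<Sum>j<m. H m j * \<eta> j) + H m m * \<eta> m = 0"
    by (simp add: \<eta>_def r_def)
  have "quad_form (Suc m) H \<eta> = quad_form m H \<xi> + (\<Sum>i<m. star (\<xi> i) * H i m) * (- g * r)"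
    unfolding quad_form_Suc z by (simp add: \<eta>_def cong: quad_form_cong)
  also have "\<dots> = quad_form m ?H \<xi>"
    by (simp add: quad_form_def r_def sum_subtractf sum_distrib_left sum_distrib_right algebra_simps
        sum_negf) (rule sum.swap)
  finally have q: "quad_form (Suc m) H \<eta> = quad_form m ?H \<xi>" .
  have "(\<Sum>j\<in>{1..<Suc m}. star (\<eta> j) * \<eta> j) = (\<Sum>j\<in>{1..<m}. star (\<xi> j) * \<xi> j) + star (\<eta> m) * \<eta> m"
    using m by (simp add: \<eta>_def)
  then have "psd (im2 (quad_form m ?H \<xi>) - star (\<xi> 0) * k * \<xi> 0 -
     e *\<^sub>R ((\<Sum>j\<in>{1..<m}. star (\<xi> j) * \<xi> j) + star (\<eta> m) * \<eta> m))"
    using H[unfolded dissipative_def, rule_format, of \<eta>] q m by (simp add: \<eta>_def)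
  \<comment> \<open>The surplus from the last coordinate is discarded here; this is where
    elimination uses the positivity of \<open>star v * v\<close>.\<close>
  from psd_add[OF this psd_scaleR[OF psd_star_mult_self[of "\<eta> m"], of e]]
  show "psd (im2 (quad_form m ?H \<xi>) - star (\<xi> 0) * k * \<xi> 0 -
     e *\<^sub>R (\<Sum>j\<in>{1..<m}. star (\<xi> j) * \<xi> j))"
    using e by (simp add: algebra_simps)
qed

lemma dissipative_invertible:
  fixes H :: "nat \<Rightarrow> nat \<Rightarrow> 'a::cstar_algebra"
  assumes "dissipative (Suc m) k e H" "e > 0" "psd (k - d *\<^sub>R 1)" "d > 0"
  shows "\<exists>G. mutually_inverse (Suc m) (Matrix.mat (Suc m) (Suc m) (\<lambda>(i, j). H i j)) G"
  using assms(1)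
proof (induction m arbitrary: H)
  case 0
  \<comment> \<open>At size 1 the sum over \<open>{1..<1}\<close> is empty, so \<open>e\<close>
    gives nothing and the lower bound on \<open>k\<close> must make this pivot invertible.\<close>
  have "psd (im2 (H 0 0) - k)"
    using 0[unfolded dissipative_def, rule_format, of "\<lambda>_. 1"] by (simp add: quad_form_def)
  from psd_add[OF this assms(3)] have "psd (im2 (H 0 0) - d *\<^sub>R 1)" by simp
  then have "invertible_elem (H 0 0)" by (rule im2_invertible) (fact assms(4))
  then obtain g where "H 0 0 * g = 1" "g * H 0 0 = 1" by (auto elim!: invertible_elemE)
  then show ?case
    by (intro exI[of _ "Matrix.mat 1 1 (\<lambda>_. g)"])
      (auto simp: mutually_inverse_def scalar_prod_def intro!: eq_matI)
next
  case (Suc m)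
  let ?m = "Suc m"
  have "invertible_elem (H ?m ?m)"
    using dissipative_pivot[OF Suc.prems _ assms(2)] by simp
  then obtain g where g: "H ?m ?m * g = 1" "g * H ?m ?m = 1" by (auto elim!: invertible_elemE)
  have "dissipative ?m k e (\<lambda>i j. H i j - H i ?m * g * H ?m j)"
    using dissipative_schur[OF Suc.prems _ assms(2) g(1)] by simp
  then obtain G where G: "mutually_inverse ?m (Matrix.mat ?m ?m (\<lambda>(i, j). H i j - H i ?m * g * H ?m j)) G"
    using Suc.IH by blast
  \<comment> \<open>\<open>X * D\<close> and \<open>D * Y\<close> are the last column and row, and
    \<open>X * (D * Y)\<close> is the term that the Schur complement subtracts.\<close>
  define X where "X = Matrix.mat ?m 1 (\<lambda>(i, j). H i ?m * g)"
  define Y where "Y = Matrix.mat 1 ?m (\<lambda>(i, j). g * H ?m j)"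
  define D where "D = Matrix.mat 1 1 (\<lambda>_. H ?m ?m)"
  have D: "mutually_inverse 1 D (Matrix.mat 1 1 (\<lambda>_. g))"
    using g by (auto simp: D_def mutually_inverse_def scalar_prod_def intro!: eq_matI)
  have cX: "X \<in> carrier_mat ?m 1" "Y \<in> carrier_mat 1 ?m" by (simp_all add: X_def Y_def)
  have gm: "H ?m ?m * (g * z) = z" "g * (H ?m ?m * z) = z" for z
    using g by (simp_all flip: mult.assoc)
  have DY: "D * Y = Matrix.mat 1 ?m (\<lambda>(i, j). H ?m j)"
    by (auto simp: D_def Y_def scalar_prod_def gm intro!: eq_matI)
  have XD: "X * D = Matrix.mat ?m 1 (\<lambda>(i, j). H i ?m)"
    by (auto simp: D_def X_def scalar_prod_def g mult.assoc intro!: eq_matI)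
  have XDY: "X * (D * Y) = Matrix.mat ?m ?m (\<lambda>(i, j). H i ?m * g * H ?m j)"
    unfolding DY by (auto simp: X_def scalar_prod_def intro!: eq_matI)
  have "Matrix.mat (Suc ?m) (Suc ?m) (\<lambda>(i, j). H i j) =
    four_block_mat (Matrix.mat ?m ?m (\<lambda>(i, j). H i j - H i ?m * g * H ?m j) + X * (D * Y)) (X * D) (D * Y) D"
    unfolding XDY unfolding XD DY
    by (rule eq_matI) (auto simp: D_def less_Suc_eq not_less)
  then show ?case using mutually_inverse_schur[OF G D cX] by (auto simp only: Suc_eq_plus1)
qed

section \<open>Realizations of polynomials\<close>

definition adjoint_mat :: "'a::cstar_algebra mat \<Rightarrow> 'a mat" where
  "adjoint_mat X = Matrix.mat (dim_col X) (dim_row X) (\<lambda>(i, j). star (X $$ (j, i)))"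

lemma adjoint_mat_dim [simp]:
  "dim_row (adjoint_mat X) = dim_col X" "dim_col (adjoint_mat X) = dim_row X"
  by (simp_all add: adjoint_mat_def)

lemma adjoint_mat_carrier [simp]: "X \<in> carrier_mat n m \<Longrightarrow> adjoint_mat X \<in> carrier_mat m n"
  by auto

lemma adjoint_mat_index [simp]:
  "i < dim_col X \<Longrightarrow> j < dim_row X \<Longrightarrow> adjoint_mat X $$ (i, j) = star (X $$ (j, i))"
  by (simp add: adjoint_mat_def)

lemma adjoint_mat_mult:
  assumes "dim_col X = dim_row Y"
  shows "adjoint_mat (X * Y) = adjoint_mat Y * adjoint_mat X"
  using assms by (auto intro!: eq_matI simp: scalar_prod_def star_sum star_mult)

lemma adjoint_mat_one [simp]: "adjoint_mat (1\<^sub>m n) = 1\<^sub>m n"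
  by (auto intro!: eq_matI)

lemma adjoint_mat_adjoint_mat [simp]: "adjoint_mat (adjoint_mat X) = X"
  by (auto intro!: eq_matI simp: star_star)

lemma mutually_inverse_adjoint_mat:
  "mutually_inverse n T T' \<Longrightarrow> mutually_inverse n (adjoint_mat T) (adjoint_mat T')"
  unfolding mutually_inverse_def
  by (metis adjoint_mat_carrier adjoint_mat_mult adjoint_mat_one carrier_matD)

lemma elements_mat_subset_iff:
  "elements_mat X \<subseteq> S \<longleftrightarrow> (\<forall>i<dim_row X. \<forall>j<dim_col X. X $$ (i, j) \<in> S)"
proof -
  have "X $$ (i, j) \<in> elements_mat X" if "i < dim_row X" "j < dim_col X" for i j
    using that unfolding elements_mat_def by force
  then show ?thesis by (auto dest!: elements_matD)
qed

lemma uminus_zero_mat: "- (0\<^sub>m n m :: 'a::group_add mat) = 0\<^sub>m n m"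
  by (auto intro!: eq_matI)

lemma elements_mat_four_block:
  assumes "elements_mat X \<subseteq> S" "elements_mat Y \<subseteq> S" "elements_mat Z \<subseteq> S" "elements_mat W \<subseteq> S"
    and "dim_row Y = dim_row X" "dim_col Y = dim_col W" "dim_row Z = dim_row W" "dim_col Z = dim_col X"
  shows "elements_mat (four_block_mat X Y Z W) \<subseteq> S"
  using assms unfolding elements_mat_subset_iff by auto

lemma elements_mat_zero: "0 \<in> S \<Longrightarrow> elements_mat (0\<^sub>m n m) \<subseteq> S"
  by (auto simp: elements_mat_subset_iff)

text \<open>The variables carry complex coefficients only, as in the linearization sought;
  coefficients from \<open>B\<close> beside a variable arise by multiplying realizations. \<gamma>
  and \<open>\<gamma>'\<close> are independent because a realization's pencil need not be
  self-adjoint.\<close>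

definition affine_terms :: "'a::cstar_algebra set \<Rightarrow> nat \<Rightarrow> (nat \<Rightarrow> 'a) \<Rightarrow> 'a set" where
  "affine_terms B n x = {(\<Sum>i\<in>{1..n}. \<gamma> i *\<^sub>C x i + \<gamma>' i *\<^sub>C star (x i)) + b | \<gamma> \<gamma>' b. b \<in> B}"

lemma affine_terms_star:
  assumes B: "star_subalgebra B" and a: "a \<in> affine_terms B n x"
  shows "star a \<in> affine_terms B n x"
proof -
  obtain \<gamma> \<gamma>' b where b: "b \<in> B" and a: "a = (\<Sum>i\<in>{1..n}. \<gamma> i *\<^sub>C x i + \<gamma>' i *\<^sub>C star (x i)) + b"
    using a by (auto simp: affine_terms_def)
  have "star a = (\<Sum>i\<in>{1..n}. cnj (\<gamma>' i) *\<^sub>C x i + cnj (\<gamma> i) *\<^sub>C star (x i)) + star b"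
    by (simp add: a star_add star_sum star_scaleC star_star add.commute)
  with b B show ?thesis
    unfolding affine_terms_def star_subalgebra_def mem_Collect_eq
    by (intro exI[of _ "\<lambda>i. cnj (\<gamma>' i)"] exI[of _ "\<lambda>i. cnj (\<gamma> i)"] exI[of _ "star b"]) auto
qed

lemma affine_terms_uminus:
  assumes B: "star_subalgebra B" and a: "a \<in> affine_terms B n x"
  shows "- a \<in> affine_terms B n x"
proof -
  obtain \<gamma> \<gamma>' b where b: "b \<in> B" and a: "a = (\<Sum>i\<in>{1..n}. \<gamma> i *\<^sub>C x i + \<gamma>' i *\<^sub>C star (x i)) + b"
    using a by (auto simp: affine_terms_def)
  have "- b \<in> B"
    using b B unfolding star_subalgebra_def by (metis scaleC_minus_left scaleC_one)
  moreover have "- a = (\<Sum>i\<in>{1..n}. (- \<gamma> i) *\<^sub>C x i + (- \<gamma>' i) *\<^sub>C star (x i)) + (- b)"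
    by (simp add: a sum.distrib sum_negf sum_subtractf)
  ultimately show ?thesis
    unfolding affine_terms_def mem_Collect_eq
    by (intro exI[of _ "\<lambda>i. - \<gamma> i"] exI[of _ "\<lambda>i. - \<gamma>' i"] exI[of _ "- b"]) auto
qed

lemma subset_affine_terms: "B \<subseteq> affine_terms B n x"
proof
  fix b assume "b \<in> B"
  then show "b \<in> affine_terms B n x"
    unfolding affine_terms_def mem_Collect_eq
    by (intro exI[of _ "\<lambda>_. 0"] exI[of _ b]) simp
qed

lemma variable_affine_terms:
  assumes "0 \<in> B" "i \<in> {1..n}"
  shows "x i \<in> affine_terms B n x"
proof -
  have "(\<Sum>j\<in>{1..n}. (if j = i then 1 else 0) *\<^sub>C x j + 0 *\<^sub>C star (x j)) = x i"
    using assms(2) by (simp add: if_distrib[of "\<lambda>z. z *\<^sub>C _"] cong: if_cong)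
  then show ?thesis using assms(1)
    unfolding affine_terms_def mem_Collect_eq
    by (intro exI[of _ "\<lambda>j. if j = i then 1 else 0"] exI[of _ "\<lambda>_. 0"] exI[of _ 0]) simp
qed

text \<open>\<open>u\<close> and \<open>v\<close> are confined to \<open>B\<close>: in a product the
  block \<open>v * s\<close> enters the new pencil and must again be affine.\<close>

definition realization ::
  "'a::cstar_algebra set \<Rightarrow> nat \<Rightarrow> (nat \<Rightarrow> 'a) \<Rightarrow> nat \<Rightarrow> 'a mat \<Rightarrow> 'a mat \<Rightarrow> 'a mat \<Rightarrow> 'a mat \<Rightarrow> 'a \<Rightarrow> bool"
  where "realization B n x k u T T' v p \<longleftrightarrow> mutually_inverse k T T' \<and>
    elements_mat T \<subseteq> affine_terms B n x \<and>
    u \<in> carrier_mat 1 k \<and> elements_mat u \<subseteq> B \<and> v \<in> carrier_mat k 1 \<and> elements_mat v \<subseteq> B \<and>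
    u * (T' * v) = Matrix.mat 1 1 (\<lambda>_. p)"

definition realizable :: "'a::cstar_algebra set \<Rightarrow> nat \<Rightarrow> (nat \<Rightarrow> 'a) \<Rightarrow> 'a set" where
  "realizable B n x = {p. \<exists>k u T T' v. realization B n x k u T T' v p}"

text \<open>The unipotent pencil \<open>(1, - a; 0, 1)\<close> has the inverse
  \<open>(1, a; 0, 1)\<close>, whose upper right corner is picked out by \<open>u\<close> and
  \<open>v\<close>.\<close>

lemma realizable_affine:
  assumes B: "star_subalgebra B" "1 \<in> B" and a: "a \<in> affine_terms B n x"
  shows "a \<in> realizable B n x"
proof -
  define E where "E = (\<lambda>c. Matrix.mat 2 2 (\<lambda>(i, j). if i = j then 1 else if i < j then c else 0 :: 'a))"
  have E: "E c * E (- c) = 1\<^sub>m 2" for c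
    by (auto simp: E_def scalar_prod_def numeral_2_eq_2 less_Suc_eq intro!: eq_matI)
  have inv: "mutually_inverse 2 (E (- a)) (E a)"
    using E[of a] E[of "- a"] by (simp add: mutually_inverse_def) (simp add: E_def)
  have 01: "0 \<in> B" "1 \<in> B" using B by (auto simp: star_subalgebra_def)
  then have T: "elements_mat (E (- a)) \<subseteq> affine_terms B n x"
    using affine_terms_uminus[OF B(1) a] subset_affine_terms[of B n x]
    by (auto simp: elements_mat_subset_iff E_def)
  let ?u = "Matrix.mat 1 2 (\<lambda>(i, j). if j = 0 then 1 else 0 :: 'a)"
  let ?v = "Matrix.mat 2 1 (\<lambda>(i, j). if i = 0 then 0 else 1 :: 'a)"
  have "elements_mat ?u \<subseteq> B" "elements_mat ?v \<subseteq> B"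
    using 01 by (auto simp: elements_mat_subset_iff)
  moreover have "?u * (E a * ?v) = Matrix.mat 1 1 (\<lambda>_. a)"
    by (auto simp: E_def scalar_prod_def numeral_2_eq_2 intro!: eq_matI)
  ultimately have "realization B n x 2 ?u (E (- a)) (E a) ?v a"
    using inv T by (simp add: realization_def)
  then show ?thesis unfolding realizable_def by blast
qed

lemma realizable_star:
  assumes B: "star_subalgebra B" and p: "p \<in> realizable B n x"
  shows "star p \<in> realizable B n x"
proof -
  obtain k u T T' v where r: "realization B n x k u T T' v p"
    using p by (auto simp: realizable_def)
  then have d: "dim_row u = 1" "dim_col u = k" "dim_row v = k" "dim_col v = 1"
    "dim_row T = k" "dim_col T = k" "dim_row T' = k" "dim_col T' = k"
    by (auto simp: realization_def mutually_inverse_def)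
  have "adjoint_mat v * (adjoint_mat T' * adjoint_mat u) = adjoint_mat (u * (T' * v))"
    by (simp add: adjoint_mat_mult mat_mult_assoc_dim d)
  also have "\<dots> = Matrix.mat 1 1 (\<lambda>_. star p)"
    using r by (auto simp: realization_def intro!: eq_matI)
  finally have "realization B n x k (adjoint_mat v) (adjoint_mat T) (adjoint_mat T') (adjoint_mat u) (star p)"
    using r B unfolding realization_def elements_mat_subset_iff
    by (auto simp: mutually_inverse_adjoint_mat d star_subalgebra_def intro!: affine_terms_star[OF B])
  then show ?thesis unfolding realizable_def by blast
qed

lemma realizable_add:
  assumes B: "star_subalgebra B" and p: "p \<in> realizable B n x" and q: "q \<in> realizable B n x"
  shows "p + q \<in> realizable B n x"
proof -
  obtain k u T T' v where r: "realization B n x k u T T' v p"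
    using p by (auto simp: realizable_def)
  obtain l s S S' t where r': "realization B n x l s S S' t q"
    using q by (auto simp: realizable_def)
  have 0: "0 \<in> B" "0 \<in> affine_terms B n x"
    using B subset_affine_terms[of B n x] by (auto simp: star_subalgebra_def)
  have c: "u \<in> carrier_mat 1 k" "T \<in> carrier_mat k k" "T' \<in> carrier_mat k k" "v \<in> carrier_mat k 1"
    "s \<in> carrier_mat 1 l" "S \<in> carrier_mat l l" "S' \<in> carrier_mat l l" "t \<in> carrier_mat l 1"
    using r r' by (auto simp: realization_def mutually_inverse_def)
  have d: "dim_row u = 1" "dim_col u = k" "dim_row v = k" "dim_col v = 1"
    "dim_row T = k" "dim_col T = k" "dim_row T' = k" "dim_col T' = k"
    "dim_row s = 1" "dim_col s = l" "dim_row t = l" "dim_col t = 1"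
    "dim_row S = l" "dim_col S = l" "dim_row S' = l" "dim_col S' = l"
    using c by auto
  \<comment> \<open>Blocks without rows or columns make a row or column of two blocks into a
    four-block matrix, so one multiplication rule covers all products.\<close>
  let ?u = "four_block_mat u s (0\<^sub>m 0 k) (0\<^sub>m 0 l)"
  let ?v = "four_block_mat v (0\<^sub>m k 0) t (0\<^sub>m l 0)"
  let ?T = "four_block_mat T (0\<^sub>m k l) (0\<^sub>m l k) S"
  let ?T' = "four_block_mat T' (0\<^sub>m k l) (0\<^sub>m l k) S'"
  have inv: "mutually_inverse (k + l) ?T ?T'"
    using mutually_inverse_schur[of k T T' l S S' "0\<^sub>m k l" "0\<^sub>m l k"] r r' c
    by (simp add: realization_def uminus_zero_mat)
  have eq: "?u * (?T' * ?v) = Matrix.mat 1 1 (\<lambda>_. p + q)"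
  proof -
    have "?T' * ?v = four_block_mat (T' * v) (0\<^sub>m k 0) (S' * t) (0\<^sub>m l 0)"
      by (subst mult_four_block_mat[of _ k k _ l _ l _ _ 1 _ 0]) (use c in auto)
    also have "?u * \<dots> = four_block_mat (u * (T' * v) + s * (S' * t)) (0\<^sub>m 1 0) (0\<^sub>m 0 1) (0\<^sub>m 0 0)"
      by (subst mult_four_block_mat[of _ 1 k _ l _ 0 _ _ 1 _ 0]) (use c in auto)
    also have "\<dots> = Matrix.mat 1 1 (\<lambda>_. p + q)"
      using r r' by (auto simp: realization_def intro!: eq_matI)
    finally show ?thesis .
  qed
  have el: "elements_mat T \<subseteq> affine_terms B n x" "elements_mat S \<subseteq> affine_terms B n x"
    "elements_mat u \<subseteq> B" "elements_mat v \<subseteq> B" "elements_mat s \<subseteq> B" "elements_mat t \<subseteq> B"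
    using r r' unfolding realization_def by - (elim conjE, assumption)+
  have T: "elements_mat ?T \<subseteq> affine_terms B n x"
    by (rule elements_mat_four_block) (simp_all add: el elements_mat_zero 0 d)
  have E: "elements_mat ?u \<subseteq> B"
    by (rule elements_mat_four_block) (simp_all add: el elements_mat_zero 0 d)
  have E': "elements_mat ?v \<subseteq> B"
    by (rule elements_mat_four_block) (simp_all add: el elements_mat_zero 0 d)
  have cu: "?u \<in> carrier_mat 1 (k + l)" and cv: "?v \<in> carrier_mat (k + l) 1"
    by (rule carrier_matI; simp add: d)+
  have "realization B n x (k + l) ?u ?T ?T' ?v (p + q)"
    unfolding realization_def using inv T E E' cu cv eq by - (intro conjI; assumption)
  then show ?thesis unfolding realizable_def by blast
qed

text \<open>The triangular pencil \<open>(T, - v s; 0, S)\<close> has \<open>T' v s S'\<close> as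
  the corner of its inverse, and \<open>u T' v s S' t\<close> is \<open>p * q\<close>.\<close>

lemma realizable_mult:
  assumes B: "star_subalgebra B" and p: "p \<in> realizable B n x" and q: "q \<in> realizable B n x"
  shows "p * q \<in> realizable B n x"
proof -
  obtain k u T T' v where r: "realization B n x k u T T' v p"
    using p by (auto simp: realizable_def)
  obtain l s S S' t where r': "realization B n x l s S S' t q"
    using q by (auto simp: realizable_def)
  have 0: "0 \<in> B" "0 \<in> affine_terms B n x"
    using B subset_affine_terms[of B n x] by (auto simp: star_subalgebra_def)
  have c: "u \<in> carrier_mat 1 k" "T \<in> carrier_mat k k" "T' \<in> carrier_mat k k" "v \<in> carrier_mat k 1"
    "s \<in> carrier_mat 1 l" "S \<in> carrier_mat l l" "S' \<in> carrier_mat l l" "t \<in> carrier_mat l 1"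
    and i: "S' * S = 1\<^sub>m l"
    using r r' by (auto simp: realization_def mutually_inverse_def)
  have d: "dim_row u = 1" "dim_col u = k" "dim_row v = k" "dim_col v = 1"
    "dim_row T = k" "dim_col T = k" "dim_row T' = k" "dim_col T' = k"
    "dim_row s = 1" "dim_col s = l" "dim_row t = l" "dim_col t = 1"
    "dim_row S = l" "dim_col S = l" "dim_row S' = l" "dim_col S' = l"
    using c by auto
  let ?u = "four_block_mat u (0\<^sub>m 1 l) (0\<^sub>m 0 k) (0\<^sub>m 0 l)"
  let ?v = "four_block_mat (0\<^sub>m k 1) (0\<^sub>m k 0) t (0\<^sub>m l 0)"
  let ?T = "four_block_mat T (- (v * s)) (0\<^sub>m l k) S"
  let ?T' = "four_block_mat T' (T' * (v * (s * S'))) (0\<^sub>m l k) S'"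
  \<comment> \<open>\<open>mutually_inverse_schur\<close> wants the off-diagonal block as
    \<open>X * D\<close> with \<open>D = S\<close>, hence the extra factor
    \<open>S'\<close>.\<close>
  have X: "- (v * (s * S')) * S = - (v * s)"
    by (simp add: mat_mult_assoc_dim mat_mult_uminus_dim d i del: assoc_mult_mat)
  have cX: "- (v * (s * S')) \<in> carrier_mat k l" using c by auto
  have "- (T' * - (v * (s * S'))) = T' * (v * (s * S'))"
    by (simp add: mat_mult_uminus_dim d)
  then have inv: "mutually_inverse (k + l) ?T ?T'"
    using mutually_inverse_schur[of k T T' l S S' "- (v * (s * S'))" "0\<^sub>m l k"] r r' c X cX
    by (simp add: realization_def uminus_zero_mat)
  have eq: "?u * (?T' * ?v) = Matrix.mat 1 1 (\<lambda>_. p * q)"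
  proof -
    have "?T' * ?v = four_block_mat (T' * (v * (s * (S' * t)))) (0\<^sub>m k 0) (S' * t) (0\<^sub>m l 0)"
      by (subst mult_four_block_mat[of _ k k _ l _ l _ _ 1 _ 0])
        (use c in \<open>auto simp: mat_mult_assoc_dim d\<close>)
    also have "?u * \<dots> = four_block_mat (u * (T' * (v * (s * (S' * t))))) (0\<^sub>m 1 0) (0\<^sub>m 0 1) (0\<^sub>m 0 0)"
      by (subst mult_four_block_mat[of _ 1 k _ l _ 0 _ _ 1 _ 0]) (use c in auto)
    also have "u * (T' * (v * (s * (S' * t)))) = u * (T' * v) * (s * (S' * t))"
      by (simp add: mat_mult_assoc_dim d)
    also have "\<dots> = Matrix.mat 1 1 (\<lambda>_. p) * Matrix.mat 1 1 (\<lambda>_. q)"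
      using r r' by (simp add: realization_def)
    also have "four_block_mat \<dots> (0\<^sub>m 1 0) (0\<^sub>m 0 1) (0\<^sub>m 0 0) = Matrix.mat 1 1 (\<lambda>_. p * q)"
      by (auto simp: scalar_prod_def intro!: eq_matI)
    finally show ?thesis .
  qed
  have TE: "elements_mat (- (v * s)) \<subseteq> affine_terms B n x"
  proof -
    have "elements_mat (v * s) \<subseteq> B"
      using r r' B by (auto simp: elements_mat_subset_iff realization_def scalar_prod_def star_subalgebra_def)
    then show ?thesis
      using subset_affine_terms[of B n x] by (auto simp: elements_mat_subset_iff intro!: affine_terms_uminus[OF B])
  qed
  have el: "elements_mat T \<subseteq> affine_terms B n x" "elements_mat S \<subseteq> affine_terms B n x"
    "elements_mat u \<subseteq> B" "elements_mat v \<subseteq> B" "elements_mat s \<subseteq> B" "elements_mat t \<subseteq> B"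
    using r r' unfolding realization_def by - (elim conjE, assumption)+
  have T: "elements_mat ?T \<subseteq> affine_terms B n x"
    by (rule elements_mat_four_block) (simp_all add: el TE elements_mat_zero 0 d)
  have E: "elements_mat ?u \<subseteq> B"
    by (rule elements_mat_four_block) (simp_all add: el elements_mat_zero 0 d)
  have E': "elements_mat ?v \<subseteq> B"
    by (rule elements_mat_four_block) (simp_all add: el elements_mat_zero 0 d)
  have cu: "?u \<in> carrier_mat 1 (k + l)" and cv: "?v \<in> carrier_mat (k + l) 1"
    by (rule carrier_matI; simp add: d)+
  have "realization B n x (k + l) ?u ?T ?T' ?v (p * q)"
    unfolding realization_def using inv T E E' cu cv eq by - (intro conjI; assumption)
  then show ?thesis unfolding realizable_def by blast
qed

lemma valued_polynomials_realizable:
  assumes B: "star_subalgebra B" "1 \<in> B"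
  shows "valued_polynomials B n x \<subseteq> realizable B n x"
  unfolding valued_polynomials_def
proof (rule hull_minimal)
  have 0: "0 \<in> B" using B by (simp add: star_subalgebra_def)
  show "B \<union> x ` {1..n} \<subseteq> realizable B n x"
    using subset_affine_terms[of B n x] variable_affine_terms[OF 0]
    by (auto intro!: realizable_affine[OF B])
  have "z *\<^sub>C p \<in> realizable B n x" if p: "p \<in> realizable B n x" for z p
  proof -
    have "z *\<^sub>C 1 \<in> B" using B by (simp add: star_subalgebra_def)
    then have "z *\<^sub>C 1 * p \<in> realizable B n x"
      using subset_affine_terms[of B n x] by (blast intro: realizable_mult[OF B(1) realizable_affine[OF B] p])
    then show ?thesis by (simp add: mult_scaleC_left)
  qed
  moreover have "0 \<in> realizable B n x"
    using 0 subset_affine_terms[of B n x] by (intro realizable_affine[OF B]) auto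
  ultimately show "star_subalgebra (realizable B n x)"
    unfolding star_subalgebra_def
    by (auto intro: realizable_add[OF B(1)] realizable_mult[OF B(1)] realizable_star[OF B(1)])
qed

section \<open>Self-adjoint linearization and the limit\<close>

lemma abelian_monoid_ring_mat: "abelian_monoid (ring_mat TYPE('a::ring_1) m b)"
  by (unfold_locales) (auto simp: ring_mat_def)

lemma monoid_ring_mat: "monoid (ring_mat TYPE('a::ring_1) m b)"
  by (unfold_locales) (auto simp: ring_mat_def)

lemma finsum_ring_mat:
  fixes f :: "'i \<Rightarrow> 'a::ring_1 mat"
  assumes "finite I" "\<And>i. i \<in> I \<Longrightarrow> f i \<in> carrier_mat m m"
  shows "finsum (ring_mat TYPE('a) m b) f I = Matrix.mat m m (\<lambda>kl. \<Sum>i\<in>I. f i $$ kl)"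
  using assms
proof (induction I)
  case empty
  interpret abelian_monoid "ring_mat TYPE('a) m b" by (rule abelian_monoid_ring_mat)
  show ?case by (auto simp: ring_mat_simps intro!: eq_matI)
next
  case (insert i I)
  interpret abelian_monoid "ring_mat TYPE('a) m b" by (rule abelian_monoid_ring_mat)
  have "finsum (ring_mat TYPE('a) m b) f (insert i I) = f i + finsum (ring_mat TYPE('a) m b) f I"
    using insert by (subst finsum_insert) (auto simp: ring_mat_simps)
  also have "\<dots> = Matrix.mat m m (\<lambda>kl. \<Sum>i\<in>insert i I. f i $$ kl)"
    using insert by (auto intro!: eq_matI)
  finally show ?case .
qed

lemma mutually_inverse_Units:
  fixes X :: "'a::ring_1 mat"
  assumes "mutually_inverse m X Y"
  shows "X \<in> Units (ring_mat TYPE('a) m b)" "inv\<^bsub>ring_mat TYPE('a) m b\<^esub> X = Y"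
proof -
  interpret monoid "ring_mat TYPE('a) m b" by (rule monoid_ring_mat)
  show "X \<in> Units (ring_mat TYPE('a) m b)"
    using assms unfolding Units_def mutually_inverse_def ring_mat_simps by blast
  show "inv\<^bsub>ring_mat TYPE('a) m b\<^esub> X = Y"
    by (rule inv_char) (use assms in \<open>auto simp: mutually_inverse_def ring_mat_simps\<close>)
qed

text \<open>Averaging an arbitrary affine expression of \<open>L\<close> with its adjoint makes the coefficients of
  \<open>x\<^sub>i\<close> and \<open>x\<^sub>i\<^sup>*\<close> adjoint to each other.\<close>

lemma selfadjoint_affine_decomposition:
  fixes L :: "'a::cstar_algebra mat"
  assumes B: "star_subalgebra B" and L: "L \<in> carrier_mat m m" "adjoint_mat L = L"
    and aff: "elements_mat L \<subseteq> affine_terms B n x"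
  shows "\<exists>c0\<in>matrices_over m B. \<exists>c. (\<forall>i\<in>{1..n}. c i \<in> carrier_mat m m) \<and>
       L = (\<Oplus>\<^bsub>matrix_algebra TYPE('a) m\<^esub>i\<in>{1..n}.
              (c i \<otimes>\<^sub>m x i) + (mat_adjoint (c i) \<otimes>\<^sub>m star (x i))) + c0"
proof -
  \<comment> \<open>Guarding the condition by the index bounds makes witnesses exist for all
    \<open>k\<close> and \<open>l\<close>, so the coefficients can be chosen as total
    functions.\<close>
  define E where "E = (\<lambda>k l w. k < m \<and> l < m \<longrightarrow> snd (snd w) \<in> B \<and>
      L $$ (k, l) = (\<Sum>i\<in>{1..n}. fst w i *\<^sub>C x i + fst (snd w) i *\<^sub>C star (x i)) + snd (snd w))"
  have "\<exists>w. E k l w" for k l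
  proof (cases "k < m \<and> l < m")
    case True
    then have "L $$ (k, l) \<in> affine_terms B n x"
      using aff L(1) by (auto simp: elements_mat_subset_iff)
    then obtain g g' b where "b \<in> B" "L $$ (k, l) = (\<Sum>i\<in>{1..n}. g i *\<^sub>C x i + g' i *\<^sub>C star (x i)) + b"
      by (auto simp: affine_terms_def)
    then show ?thesis by (intro exI[of _ "(g, g', b)"]) (simp add: E_def)
  next
    case False
    then show ?thesis by (simp add: E_def del: de_Morgan_conj)
  qed
  then obtain w where w: "E k l (w k l)" for k l by metis
  define \<gamma> \<gamma>' \<beta> where "\<gamma> = (\<lambda>k l. fst (w k l))" and "\<gamma>' = (\<lambda>k l. fst (snd (w k l)))"
    and "\<beta> = (\<lambda>k l. snd (snd (w k l)))"
  have \<beta>: "\<beta> k l \<in> B"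
    and L_eq: "L $$ (k, l) = (\<Sum>i\<in>{1..n}. \<gamma> k l i *\<^sub>C x i + \<gamma>' k l i *\<^sub>C star (x i)) + \<beta> k l"
    if "k < m" "l < m" for k l
    using w[of k l] that by (simp_all add: E_def \<gamma>_def \<gamma>'_def \<beta>_def)
  \<comment> \<open>At \<open>(k, l)\<close> the variable \<open>x i\<close> has the coefficient
    \<open>\<gamma> k l i\<close> from \<open>L\<close>, and \<open>cnj (\<gamma>' l k i)\<close>
    from its adjoint, where it stems from \<open>star (x i)\<close> at
    \<open>(l, k)\<close>.\<close>
  define c where "c = (\<lambda>i. Matrix.mat m m (\<lambda>(k, l). (\<gamma> k l i + cnj (\<gamma>' l k i)) / 2))"
  define c0 where "c0 = Matrix.mat m m (\<lambda>(k, l). (1 / 2) *\<^sub>C (\<beta> k l + star (\<beta> l k)))"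
  have c: "c i \<in> carrier_mat m m" for i by (simp add: c_def)
  have adj: "mat_adjoint (c i) = Matrix.mat m m (\<lambda>(k, l). (cnj (\<gamma> l k i) + \<gamma>' k l i) / 2)" for i
    by (auto simp: mat_adjoint_def mat_of_rows_index c_def intro!: eq_matI)
  have "c0 \<in> matrices_over m B"
    using \<beta> B unfolding matrices_over_def mem_Collect_eq elements_mat_subset_iff
    by (auto simp: c0_def star_subalgebra_def)
  moreover have "L = (\<Oplus>\<^bsub>matrix_algebra TYPE('a) m\<^esub>i\<in>{1..n}.
              (c i \<otimes>\<^sub>m x i) + (mat_adjoint (c i) \<otimes>\<^sub>m star (x i))) + c0"
  proof (rule eq_matI)
    let ?f = "\<lambda>i. (c i \<otimes>\<^sub>m x i) + (mat_adjoint (c i) \<otimes>\<^sub>m star (x i))"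
    have f: "?f i \<in> carrier_mat m m" for i using c by (simp add: tensor_def adj)
    have S: "finsum (matrix_algebra TYPE('a) m) ?f {1..n} = Matrix.mat m m (\<lambda>kl. \<Sum>i\<in>{1..n}. ?f i $$ kl)"
      by (rule finsum_ring_mat) (use f in auto)
    fix k l assume "k < dim_row (finsum (matrix_algebra TYPE('a) m) ?f {1..n} + c0)"
      "l < dim_col (finsum (matrix_algebra TYPE('a) m) ?f {1..n} + c0)"
    then have kl: "k < m" "l < m" by (auto simp: c0_def)
    have "L $$ (k, l) = star (L $$ (l, k))"
      using L kl by (metis adjoint_mat_index carrier_matD)
    moreover have "a = (1 / 2) *\<^sub>C (a + a)" for a :: 'a
      by (simp add: scaleC_add_right flip: scaleC_add_left)
    ultimately have "L $$ (k, l) = (1 / 2) *\<^sub>C (L $$ (k, l) + star (L $$ (l, k)))"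
      by metis
    also have "\<dots> = (\<Sum>i\<in>{1..n}. ((\<gamma> k l i + cnj (\<gamma>' l k i)) / 2) *\<^sub>C x i +
        ((cnj (\<gamma> l k i) + \<gamma>' k l i) / 2) *\<^sub>C star (x i)) + (1 / 2) *\<^sub>C (\<beta> k l + star (\<beta> l k))"
      using kl by (simp add: L_eq star_add star_sum star_scaleC star_star scaleC_add_right scaleC_add_left
          scaleC_scaleC scaleC_sum_right add_divide_distrib sum.distrib)
    also have "\<dots> = (finsum (matrix_algebra TYPE('a) m) ?f {1..n} + c0) $$ (k, l)"
      unfolding S using kl by (simp add: c0_def tensor_def adj) (simp add: c_def)
    finally show "L $$ (k, l) = (finsum (matrix_algebra TYPE('a) m) ?f {1..n} + c0) $$ (k, l)" .
  qed (use L(1) in \<open>auto simp: c0_def\<close>)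
  ultimately show ?thesis using c by blast
qed

section \<open>Invertibility of the shifted linearization for positive \<epsilon>\<close>

lemma im2_add: "im2 (a + b) = im2 a + im2 b"
  by (simp add: im2_def star_add scaleC_diff_right scaleC_add_right)

lemma im2_sum: "im2 (\<Sum>i\<in>I. f i) = (\<Sum>i\<in>I. im2 (f i))"
  by (simp add: im2_def star_sum scaleC_sum_right flip: sum_subtractf sum_negf)

lemma im2_conjugate: "im2 (star y * a * y) = star y * im2 a * y"
  by (simp add: im2_def star_mult star_star mult_scaleC_left mult_scaleC_right algebra_simps)

text \<open>The bound is an equality: the form of the self-adjoint \<open>L\<close> has no imaginary
  part, so only the diagonal of \<open>Lambda\<close> remains. The factor 2 is the one built into
  \<open>im2\<close>.\<close>

lemma dissipative_Lambda:
  fixes L :: "'a::cstar_algebra mat"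
  assumes L: "L \<in> carrier_mat (Suc m) (Suc m)" "adjoint_mat L = L"
  shows "dissipative (Suc m) (im2 b) (2 * \<epsilon>) (\<lambda>i j. (Lambda (Suc m) \<epsilon> b - L) $$ (i, j))"
  unfolding dissipative_def
proof
  fix \<xi> :: "nat \<Rightarrow> 'a"
  let ?d = "\<lambda>j. if j = 0 then b else (\<i> * complex_of_real \<epsilon>) *\<^sub>C 1"
  define q where "q = (\<Sum>i<Suc m. \<Sum>j<Suc m. star (\<xi> i) * L $$ (i, j) * \<xi> j)"
  have star_L: "star (L $$ (i, j)) = L $$ (j, i)" if "i < Suc m" "j < Suc m" for i j
    using L that by (metis adjoint_mat_index carrier_matD)
  have "star q = (\<Sum>i<Suc m. \<Sum>j<Suc m. star (\<xi> j) * L $$ (j, i) * \<xi> i)"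
    unfolding q_def star_sum by (intro sum.cong refl) (simp add: star_mult star_star star_L mult.assoc)
  also have "\<dots> = q" unfolding q_def by (rule sum.swap)
  finally have q: "im2 (- q) = 0" by (simp add: im2_def)
  have "quad_form (Suc m) (\<lambda>i j. (Lambda (Suc m) \<epsilon> b - L) $$ (i, j)) \<xi> =
      (\<Sum>i<Suc m. \<Sum>j<Suc m. (if i = j then star (\<xi> i) * ?d j * \<xi> j else 0) - star (\<xi> i) * L $$ (i, j) * \<xi> j)"
    unfolding quad_form_def
    by (intro sum.cong refl) (use L(1) in \<open>auto simp: Lambda_def mat_diag_def algebra_simps\<close>)
  also have "\<dots> = (\<Sum>i<Suc m. star (\<xi> i) * ?d i * \<xi> i) + (- q)"
    unfolding q_def sum_subtractf by (simp add: sum.delta)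
  finally have "im2 (quad_form (Suc m) (\<lambda>i j. (Lambda (Suc m) \<epsilon> b - L) $$ (i, j)) \<xi>) =
      (\<Sum>i<Suc m. star (\<xi> i) * im2 (?d i) * \<xi> i)"
    by (simp only: im2_add q im2_sum im2_conjugate add_0_right)
  also have "\<dots> = star (\<xi> 0) * im2 b * \<xi> 0 + (\<Sum>i\<in>{1..<Suc m}. star (\<xi> i) * ((2 * \<epsilon>) *\<^sub>R 1) * \<xi> i)"
  proof -
    have "im2 ((\<i> * complex_of_real \<epsilon>) *\<^sub>C 1) = (2 * \<epsilon>) *\<^sub>R (1 :: 'a)"
    proof -
      let ?z = "(\<i> * complex_of_real \<epsilon>) *\<^sub>C (1 :: 'a)"
      have e: "(- \<i>) * (\<i> * complex_of_real \<epsilon>) = of_real \<epsilon>" by (simp add: complex_eq_iff)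
      have "star ?z = - ?z" by (simp add: star_scaleC)
      then have "im2 ?z = (- \<i>) *\<^sub>C (?z + ?z)" by (simp only: im2_def diff_minus_eq_add)
      also have "\<dots> = of_real \<epsilon> *\<^sub>C 1 + of_real \<epsilon> *\<^sub>C 1"
        unfolding scaleC_add_right scaleC_scaleC e ..
      also have "\<dots> = (2 * \<epsilon>) *\<^sub>R 1" by (simp only: mult_2 of_real_add scaleC_add_left scaleR_scaleC)
      finally show ?thesis .
    qed
    moreover have "{..<Suc m} = insert 0 {1..<Suc m}" by auto
    ultimately show ?thesis by simp
  qed
  also have "(\<Sum>i\<in>{1..<Suc m}. star (\<xi> i) * ((2 * \<epsilon>) *\<^sub>R 1) * \<xi> i) =
      (2 * \<epsilon>) *\<^sub>R (\<Sum>j\<in>{1..<Suc m}. star (\<xi> j) * \<xi> j)"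
    unfolding scaleR_sum_right by (intro sum.cong) simp_all
  finally show "psd (im2 (quad_form (Suc m) (\<lambda>i j. (Lambda (Suc m) \<epsilon> b - L) $$ (i, j)) \<xi>) -
      star (\<xi> 0) * im2 b * \<xi> 0 - (2 * \<epsilon>) *\<^sub>R (\<Sum>j\<in>{1..<Suc m}. star (\<xi> j) * \<xi> j))"
    by (simp only: add_diff_cancel_left' diff_self psd_zero)
qed

lemma Lambda_minus_invertible:
  fixes L :: "'a::cstar_algebra mat"
  assumes L: "L \<in> carrier_mat (Suc m) (Suc m)" "adjoint_mat L = L"
    and b: "psd (im2 b - d *\<^sub>R 1)" "d > 0" and \<epsilon>: "\<epsilon> > 0"
  shows "\<exists>G. mutually_inverse (Suc m) (Lambda (Suc m) \<epsilon> b - L) G"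
proof -
  have "Matrix.mat (Suc m) (Suc m) (\<lambda>(i, j). (Lambda (Suc m) \<epsilon> b - L) $$ (i, j)) = Lambda (Suc m) \<epsilon> b - L"
    using L(1) by (auto simp: Lambda_def mat_diag_def intro!: eq_matI)
  then show ?thesis
    using dissipative_invertible[OF dissipative_Lambda[OF L, of b \<epsilon>] _ b] \<epsilon> by simp
qed

section \<open>Perturbation of matrix inverses\<close>

definition entry_norm :: "'a::real_normed_algebra_1 mat \<Rightarrow> real" where
  "entry_norm X = (\<Sum>i<dim_row X. \<Sum>j<dim_col X. norm (X $$ (i, j)))"

lemma norm_index_le_entry_norm:
  assumes "i < dim_row X" "j < dim_col X"
  shows "norm (X $$ (i, j)) \<le> entry_norm X"
proof -
  have "norm (X $$ (i, j)) \<le> (\<Sum>j<dim_col X. norm (X $$ (i, j)))"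
    using assms by (intro member_le_sum) auto
  also have "\<dots> \<le> entry_norm X"
    unfolding entry_norm_def using assms
    by (intro member_le_sum[of i _ "\<lambda>i. \<Sum>j<dim_col X. norm (X $$ (i, j))"]) (auto intro: sum_nonneg)
  finally show ?thesis .
qed

lemma entry_norm_nonneg: "entry_norm X \<ge> 0"
  unfolding entry_norm_def by (intro sum_nonneg) auto

text \<open>Submultiplicativity is what the perturbation argument asks of a matrix norm; as the size
  is fixed, the sum of the entry norms controls entrywise limits.\<close>

lemma entry_norm_mult:
  assumes "X \<in> carrier_mat m m" "Y \<in> carrier_mat m m"
  shows "entry_norm (X * Y) \<le> entry_norm X * entry_norm Y"
proof -
  have "entry_norm (X * Y) = (\<Sum>i<m. \<Sum>j<m. norm (\<Sum>k<m. X $$ (i, k) * Y $$ (k, j)))"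
    using assms unfolding entry_norm_def
    by (auto intro!: sum.cong arg_cong[where f = norm] simp: scalar_prod_def atLeast0LessThan)
  also have "\<dots> \<le> (\<Sum>i<m. \<Sum>j<m. \<Sum>k<m. norm (X $$ (i, k)) * norm (Y $$ (k, j)))"
    by (intro sum_mono order_trans[OF norm_sum] norm_mult_ineq)
  also have "\<dots> = (\<Sum>i<m. \<Sum>k<m. norm (X $$ (i, k)) * (\<Sum>j<m. norm (Y $$ (k, j))))"
    unfolding sum_distrib_left by (intro sum.cong refl sum.swap)
  also have "\<dots> \<le> (\<Sum>i<m. \<Sum>k<m. norm (X $$ (i, k)) * entry_norm Y)"
  proof (intro sum_mono mult_left_mono)
    fix k assume "k \<in> {..<m}"
    then show "(\<Sum>j<m. norm (Y $$ (k, j))) \<le> entry_norm Y"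
      unfolding entry_norm_def using assms
      by (auto intro!: member_le_sum[of k _ "\<lambda>i. \<Sum>j<m. norm (Y $$ (i, j))"] sum_nonneg)
  qed auto
  also have "\<dots> = entry_norm X * entry_norm Y"
    using assms by (simp add: entry_norm_def[of X] sum_distrib_right)
  finally show ?thesis .
qed

text \<open>From \<open>R - G = G * ((Y - X) * R)\<close> and smallness, \<open>G\<close> is at most
  twice as large as \<open>R\<close>, which removes it from the estimate. Existence of
  \<open>G\<close> is assumed; for \<open>Lambda\<close> it comes from positivity.\<close>

lemma mutually_inverse_perturbation:
  fixes X :: "'a::real_normed_algebra_1 mat"
  assumes X: "mutually_inverse m X R" and Y: "mutually_inverse m Y G"
    and small: "entry_norm (Y - X) * entry_norm R \<le> 1 / 2"
  shows "entry_norm (G - R) \<le> 2 * (entry_norm R)\<^sup>2 * entry_norm (Y - X)"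
proof -
  have c: "X \<in> carrier_mat m m" "R \<in> carrier_mat m m" "Y \<in> carrier_mat m m" "G \<in> carrier_mat m m"
    and i: "X * R = 1\<^sub>m m" "G * Y = 1\<^sub>m m"
    using X Y by (auto simp: mutually_inverse_def)
  let ?E = "Y - X"
  have "G * (?E * R) = G * (Y * R - X * R)"
    using c by (simp add: minus_mult_distrib_mat)
  also have "\<dots> = G * (Y * R) - G * (X * R)"
    using c by (intro mult_minus_distrib_mat[of _ m m _ m]) auto
  also have "G * (Y * R) = (G * Y) * R" by (rule assoc_mult_mat[symmetric]) (use c in auto)
  finally have e: "G * (?E * R) = R - G" using c i by simp
  have sym: "entry_norm (G - R) = entry_norm (R - G)"
    using c unfolding entry_norm_def by (auto intro!: sum.cong simp: norm_minus_commute)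
  have tri: "entry_norm G \<le> entry_norm R + entry_norm (G - R)"
  proof -
    have "norm (G $$ (i, j)) \<le> norm (R $$ (i, j)) + norm ((G - R) $$ (i, j))" if "i < m" "j < m" for i j
      using that c norm_triangle_ineq[of "R $$ (i, j)" "G $$ (i, j) - R $$ (i, j)"] by simp
    then have "(\<Sum>i<m. \<Sum>j<m. norm (G $$ (i, j))) \<le>
        (\<Sum>i<m. \<Sum>j<m. norm (R $$ (i, j)) + norm ((G - R) $$ (i, j)))"
      by (intro sum_mono) simp
    also have "\<dots> = entry_norm R + entry_norm (G - R)"
      unfolding entry_norm_def using c by (simp add: sum.distrib)
    finally show ?thesis unfolding entry_norm_def[of G] using c by simp
  qed
  have E: "?E \<in> carrier_mat m m" using c by auto
  have "entry_norm (R - G) \<le> entry_norm G * entry_norm (?E * R)"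
    unfolding e[symmetric] by (rule entry_norm_mult) (use c E in auto)
  also have "\<dots> \<le> entry_norm G * (entry_norm ?E * entry_norm R)"
    by (intro mult_left_mono entry_norm_mult entry_norm_nonneg) (use c E in auto)
  finally have b: "entry_norm (G - R) \<le> entry_norm G * (entry_norm ?E * entry_norm R)"
    by (simp add: sym)
  also have "\<dots> \<le> entry_norm G * (1 / 2)"
    by (intro mult_left_mono small entry_norm_nonneg)
  finally have "entry_norm G \<le> 2 * entry_norm R" using tri by simp
  then have "entry_norm G * (entry_norm ?E * entry_norm R) \<le> 2 * entry_norm R * (entry_norm ?E * entry_norm R)"
    by (intro mult_right_mono mult_nonneg_nonneg entry_norm_nonneg)
  with b show ?thesis by (simp add: power2_eq_square mult_ac)
qed

lemma entry_norm_Lambda_diff: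
  assumes L: "L \<in> carrier_mat m m" and \<epsilon>: "\<epsilon> \<ge> 0"
  shows "entry_norm ((Lambda m \<epsilon> b - L) - (Lambda m 0 b - L)) \<le> real (m * m) * \<epsilon>"
proof -
  let ?E = "(Lambda m \<epsilon> b - L) - (Lambda m 0 b - L)"
  have d: "dim_row ?E = m" "dim_col ?E = m" using L by auto
  have "norm (?E $$ (i, j)) \<le> \<epsilon>" if "i < m" "j < m" for i j
    using that L \<epsilon> by (cases "i = j") (auto simp: Lambda_def mat_diag_def norm_scaleC norm_mult)
  then have "entry_norm ?E \<le> (\<Sum>i<m. \<Sum>j<m. \<epsilon>)"
    unfolding entry_norm_def d by (intro sum_mono) simp
  then show ?thesis by simp
qed

section \<open>Construction of the self-adjoint linearization\<close>

lemma adjoint_mat_four_block: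
  assumes "dim_row Y = dim_row X" "dim_col Y = dim_col W" "dim_row Z = dim_row W" "dim_col Z = dim_col X"
  shows "adjoint_mat (four_block_mat X Y Z W) =
    four_block_mat (adjoint_mat X) (adjoint_mat Z) (adjoint_mat Y) (adjoint_mat W)"
  using assms by (auto intro!: eq_matI)

lemma adjoint_mat_zero [simp]: "adjoint_mat (0\<^sub>m n m) = 0\<^sub>m m n"
  by (auto intro!: eq_matI)

lemma mutually_inverse_uminus:
  assumes "mutually_inverse n X Y"
  shows "mutually_inverse n (- X) (- Y)"
  using assms by (auto simp: mutually_inverse_def mat_mult_uminus_dim)

lemma mutually_inverse_antidiagonal:
  assumes "mutually_inverse k T T'"
  shows "mutually_inverse (k + k) (four_block_mat (0\<^sub>m k k) (adjoint_mat T) T (0\<^sub>m k k))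
    (four_block_mat (0\<^sub>m k k) T' (adjoint_mat T') (0\<^sub>m k k))"
proof -
  have c: "T \<in> carrier_mat k k" "T' \<in> carrier_mat k k" "adjoint_mat T \<in> carrier_mat k k"
    "adjoint_mat T' \<in> carrier_mat k k" and i: "T * T' = 1\<^sub>m k" "T' * T = 1\<^sub>m k"
    "adjoint_mat T * adjoint_mat T' = 1\<^sub>m k" "adjoint_mat T' * adjoint_mat T = 1\<^sub>m k"
    using assms mutually_inverse_adjoint_mat[OF assms] by (auto simp: mutually_inverse_def)
  show ?thesis
    unfolding mutually_inverse_def using c
    by (auto simp: mult_four_block_mat[of _ k k _ k _ k _ _ k _ k] i)
qed

lemma selfadjoint_linearization:
  fixes P :: "'a::cstar_algebra"
  assumes B: "star_subalgebra B" "1 \<in> B" and P: "P \<in> realizable B n x" "star P = P"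
  shows "\<exists>m L. L \<in> carrier_mat (Suc m) (Suc m) \<and> adjoint_mat L = L \<and>
    elements_mat L \<subseteq> affine_terms B n x \<and>
    (\<forall>b. invertible_elem (b - P) \<longrightarrow>
      (\<exists>R. mutually_inverse (Suc m) (Lambda (Suc m) 0 b - L) R \<and> R $$ (0, 0) = elem_inv (b - P)))"
proof -
  obtain k u T T' v where rz: "realization B n x k u T T' v P"
    using P(1) by (auto simp: realizable_def)
  then have inv: "mutually_inverse k T T'" and el: "elements_mat T \<subseteq> affine_terms B n x"
    "elements_mat u \<subseteq> B" "elements_mat v \<subseteq> B" and
    c: "u \<in> carrier_mat 1 k" "v \<in> carrier_mat k 1" and
    Peq: "u * (T' * v) = Matrix.mat 1 1 (\<lambda>_. P)"
    unfolding realization_def by - (elim conjE, assumption)+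
  have cT: "T \<in> carrier_mat k k" "T' \<in> carrier_mat k k"
    using inv by (auto simp: mutually_inverse_def)
  have d: "dim_row u = 1" "dim_col u = k" "dim_row v = k" "dim_col v = 1"
    "dim_row T = k" "dim_col T = k" "dim_row T' = k" "dim_col T' = k"
    using c cT by auto
  \<comment> \<open>Both \<open>u T' w\<close> and its adjoint occur in
    \<open>r Q' r\<^sup>*\<close>. Each supplies half of \<open>- P\<close>, and they agree because
    \<open>P\<close> is self-adjoint.\<close>
  define h where "h = Matrix.mat 1 1 (\<lambda>_. (- 1 / 2) *\<^sub>R (1 :: 'a))"
  define w where "w = v * h"
  have hd: "dim_row h = 1" "dim_col h = 1" by (simp_all add: h_def)
  have wd: "dim_row w = k" "dim_col w = 1" by (simp_all add: w_def d hd)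
  have uTw: "u * (T' * w) = Matrix.mat 1 1 (\<lambda>_. (- 1 / 2) *\<^sub>R P)"
  proof -
    have "u * (T' * w) = u * (T' * v) * h"
      by (simp add: w_def mat_mult_assoc_dim d hd)
    then show ?thesis unfolding Peq by (auto simp: h_def scalar_prod_def intro!: eq_matI)
  qed
  have aff: "elements_mat X \<subseteq> affine_terms B n x \<Longrightarrow> elements_mat (adjoint_mat X) \<subseteq> affine_terms B n x" for X
    by (auto simp: elements_mat_subset_iff intro!: affine_terms_star[OF B(1)])
  have 0: "0 \<in> affine_terms B n x"
    using B subset_affine_terms[of B n x] by (auto simp: star_subalgebra_def)
  have elw: "elements_mat w \<subseteq> affine_terms B n x"
  proof -
    have "w $$ (i, 0) \<in> B" if i: "i < k" for i
    proof -
      have "v $$ (i, 0) \<in> B" using i el(3) d by (simp add: elements_mat_subset_iff)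
      then have "(- 1 / 2) *\<^sub>C v $$ (i, 0) \<in> B" using B(1) unfolding star_subalgebra_def by blast
      moreover have "w $$ (i, 0) = (- 1 / 2) *\<^sub>C v $$ (i, 0)"
        using i d by (simp add: w_def h_def scalar_prod_def scaleR_scaleC mult_scaleC_right)
      ultimately show ?thesis by (simp only:)
    qed
    then have "elements_mat w \<subseteq> B" by (simp add: elements_mat_subset_iff wd)
    then show ?thesis using subset_affine_terms by (rule order_trans)
  qed
  have elu: "elements_mat u \<subseteq> affine_terms B n x"
    using el(2) subset_affine_terms by (rule order_trans)
  define r where "r = four_block_mat u (adjoint_mat w) (0\<^sub>m 0 k) (0\<^sub>m 0 k)"
  have r': "adjoint_mat r = four_block_mat (adjoint_mat u) (0\<^sub>m k 0) w (0\<^sub>m k 0)"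
    unfolding r_def by (subst adjoint_mat_four_block) (simp_all add: d wd)
  have rd: "dim_row r = 1" "dim_col r = k + k" by (simp_all add: r_def d wd)
  define Q where "Q = four_block_mat (0\<^sub>m k k) (adjoint_mat T) T (0\<^sub>m k k)"
  define Q' where "Q' = four_block_mat (0\<^sub>m k k) T' (adjoint_mat T') (0\<^sub>m k k)"
  have Q: "mutually_inverse (k + k) Q Q'"
    unfolding Q_def Q'_def by (rule mutually_inverse_antidiagonal[OF inv])
  then have Qi: "Q * Q' = 1\<^sub>m (k + k)" "Q' * Q = 1\<^sub>m (k + k)"
    by (auto simp: mutually_inverse_def)
  have Qd: "dim_row Q = k + k" "dim_col Q = k + k" "dim_row Q' = k + k" "dim_col Q' = k + k"
    by (simp_all add: Q_def Q'_def)
  have Qs: "adjoint_mat Q = Q"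
    unfolding Q_def by (subst adjoint_mat_four_block) (simp_all add: d)
  have rQr: "r * (Q' * adjoint_mat r) = Matrix.mat 1 1 (\<lambda>_. - P)"
  proof -
    have cc: "u \<in> carrier_mat 1 k" "adjoint_mat w \<in> carrier_mat 1 k" "w \<in> carrier_mat k 1"
      "adjoint_mat u \<in> carrier_mat k 1" "T' \<in> carrier_mat k k" "adjoint_mat T' \<in> carrier_mat k k"
      "T' * w \<in> carrier_mat k 1" "adjoint_mat T' * adjoint_mat u \<in> carrier_mat k 1"
      by (rule carrier_matI; simp add: d wd)+
    have "Q' * adjoint_mat r = four_block_mat (T' * w) (0\<^sub>m k 0) (adjoint_mat T' * adjoint_mat u) (0\<^sub>m k 0)"
      unfolding r' Q'_def
      by (subst mult_four_block_mat[of _ k k _ k _ k _ _ 1 _ 0]) (use cc in auto)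
    then have "r * (Q' * adjoint_mat r) = four_block_mat
        (u * (T' * w) + adjoint_mat w * (adjoint_mat T' * adjoint_mat u)) (0\<^sub>m 1 0) (0\<^sub>m 0 1) (0\<^sub>m 0 0)"
      unfolding r_def
      by (simp only:, subst mult_four_block_mat[of _ 1 k _ k _ 0 _ _ 1 _ 0]) (use cc in auto)
    also have "adjoint_mat w * (adjoint_mat T' * adjoint_mat u) = adjoint_mat (u * (T' * w))"
      by (simp add: adjoint_mat_mult mat_mult_assoc_dim d wd)
    also have "four_block_mat (u * (T' * w) + \<dots>) (0\<^sub>m 1 0) (0\<^sub>m 0 1) (0\<^sub>m 0 0) =
        Matrix.mat 1 1 (\<lambda>_. - P)"
      unfolding uTw by (auto simp: P(2) simp flip: scaleR_add_left scaleR_minus_left intro!: eq_matI)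
    finally show ?thesis .
  qed
  define L where "L = four_block_mat (0\<^sub>m 1 1) r (adjoint_mat r) Q"
  have Ld: "dim_row L = Suc (k + k)" "dim_col L = Suc (k + k)" by (simp_all add: L_def Qd)
  have Ls: "adjoint_mat L = L"
    unfolding L_def by (subst adjoint_mat_four_block) (simp_all add: rd Qd Qs)
  have elr: "elements_mat r \<subseteq> affine_terms B n x"
    unfolding r_def by (rule elements_mat_four_block) (simp_all add: elu elw aff elements_mat_zero 0 d wd)
  have elQ: "elements_mat Q \<subseteq> affine_terms B n x"
    unfolding Q_def by (rule elements_mat_four_block) (simp_all add: el(1) aff elements_mat_zero 0 d)
  have elL: "elements_mat L \<subseteq> affine_terms B n x"
    unfolding L_def by (rule elements_mat_four_block) (simp_all add: elr elQ aff elements_mat_zero 0 rd Qd)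
  have "\<exists>R. mutually_inverse (Suc (k + k)) (Lambda (Suc (k + k)) 0 b - L) R \<and> R $$ (0, 0) = elem_inv (b - P)"
    if b: "invertible_elem (b - P)" for b
  proof -
    \<comment> \<open>Eliminating the block \<open>- Q\<close> leaves
      \<open>b + r Q' r\<^sup>*\<close>, that is \<open>b - P\<close>; so \<open>X = r Q'\<close>,
      \<open>D = - Q\<close> and \<open>Y = Q' r\<^sup>*\<close> are the data for
      \<open>mutually_inverse_schur\<close>.\<close>
    define S where "S = Matrix.mat 1 1 (\<lambda>_. b - P)"
    define S' where "S' = Matrix.mat 1 1 (\<lambda>_. elem_inv (b - P))"
    have S: "mutually_inverse 1 S S'"
      using elem_inv[OF b] by (auto simp: mutually_inverse_def S_def S'_def scalar_prod_def intro!: eq_matI)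
    have XY: "r * Q' \<in> carrier_mat 1 (k + k)" "Q' * adjoint_mat r \<in> carrier_mat (k + k) 1"
      by (rule carrier_matI; simp add: rd Qd)+
    have 1: "r * Q' * (- Q) = - r"
      by (simp add: mat_mult_uminus_dim mat_mult_assoc_dim Qi rd Qd right_mult_one_mat')
    have "Q * (Q' * adjoint_mat r) = (Q * Q') * adjoint_mat r"
      by (simp add: mat_mult_assoc_dim rd Qd)
    then have 2: "(- Q) * (Q' * adjoint_mat r) = - adjoint_mat r"
      by (simp add: mat_mult_uminus_dim Qi rd Qd left_mult_one_mat')
    have "r * Q' * (- adjoint_mat r) = - (r * (Q' * adjoint_mat r))"
      by (simp add: mat_mult_uminus_dim mat_mult_assoc_dim rd Qd)
    then have 3: "S + r * Q' * (- adjoint_mat r) = Matrix.mat 1 1 (\<lambda>_. b)"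
      unfolding rQr by (auto simp: S_def intro!: eq_matI)
    have H: "Lambda (Suc (k + k)) 0 b - L =
        four_block_mat (Matrix.mat 1 1 (\<lambda>_. b)) (- r) (- adjoint_mat r) (- Q)"
      by (rule eq_matI) (auto simp: L_def Lambda_def mat_diag_def rd Qd)
    let ?R = "four_block_mat S' (- (S' * (r * Q'))) (- ((Q' * adjoint_mat r) * S'))
      (- Q' + (Q' * adjoint_mat r) * (S' * (r * Q')))"
    have "mutually_inverse (1 + (k + k)) (Lambda (Suc (k + k)) 0 b - L) ?R"
      using mutually_inverse_schur[OF S mutually_inverse_uminus[OF Q] XY] unfolding 1 2 3 H .
    moreover have "?R $$ (0, 0) = elem_inv (b - P)" by (simp add: S'_def rd Qd)
    ultimately show ?thesis by (metis plus_1_eq_Suc)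
  qed
  then show ?thesis using Ls elL Ld by (intro exI[of _ "k + k"] exI[of _ L]) (auto intro!: carrier_matI)
qed

theorem proposition4p1:
  fixes B :: "'a::cstar_algebra set" and F :: "'a \<Rightarrow> 'a"
    and n :: nat and x :: "nat \<Rightarrow> 'a" and P :: 'a
  assumes "cstar_probability_space B F"
    and "P \<in> valued_polynomials B n x"
    and "star P = P"
  shows "\<exists>m\<ge>1. \<exists>L\<in>carrier (matrix_algebra TYPE('a) m).
    (\<exists>c0\<in>matrices_over m B. \<exists>c. (\<forall>i\<in>{1..n}. c i \<in> carrier_mat m m) \<and>
       L = (\<Oplus>\<^bsub>matrix_algebra TYPE('a) m\<^esub>i\<in>{1..n}.
              (c i \<otimes>\<^sub>m x i) + (mat_adjoint (c i) \<otimes>\<^sub>m star (x i))) + c0) \<and>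
    (\<forall>b\<in>upper_half_plane B.
       invertible_elem (b - P) \<and>
       (\<forall>\<epsilon>>0. Lambda m \<epsilon> b - L \<in> Units (matrix_algebra TYPE('a) m)) \<and>
       ((\<lambda>\<epsilon>. matrix_cauchy_transform m F L (Lambda m \<epsilon> b) $$ (0, 0))
          \<longlongrightarrow> cauchy_transform F P b) (at_right 0))"
proof -
  interpret cstar_probability_space B F by fact
  have B: "star_subalgebra B" "1 \<in> B"
    using subalgebra by (auto simp: unital_cstar_subalgebra_def)
  have "P \<in> realizable B n x" using valued_polynomials_realizable[OF B] assms(2) by blast
  then obtain m' L where L': "L \<in> carrier_mat (Suc m') (Suc m')" "adjoint_mat L = L"
    "elements_mat L \<subseteq> affine_terms B n x"
    and R': "\<And>b. invertible_elem (b - P) \<Longrightarrow>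
      \<exists>R. mutually_inverse (Suc m') (Lambda (Suc m') 0 b - L) R \<and> R $$ (0, 0) = elem_inv (b - P)"
    using selfadjoint_linearization[OF B _ assms(3)] by blast
  define m where "m = Suc m'"
  note L = L'[folded m_def]
  have spec: "invertible_elem (b - P) \<and>
       (\<forall>\<epsilon>>0. Lambda m \<epsilon> b - L \<in> Units (matrix_algebra TYPE('a) m)) \<and>
       ((\<lambda>\<epsilon>. matrix_cauchy_transform m F L (Lambda m \<epsilon> b) $$ (0, 0))
          \<longlongrightarrow> cauchy_transform F P b) (at_right 0)" if b: "b \<in> upper_half_plane B" for b
  proof -
    obtain d where d: "d > 0" "positive_in B (im2 b - of_real d *\<^sub>C 1)"
      using b unfolding upper_half_plane_def ge_in_def im2_def by blast
    then have pos: "psd (im2 b - d *\<^sub>R 1)" by (simp add: psd_if_positive_in scaleR_scaleC)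
    have "im2 (b - P) = im2 b" using assms(3) by (simp add: im2_def star_diff)
    then have inv: "invertible_elem (b - P)"
      using im2_invertible[of "b - P" d] pos d(1) by simp
    obtain R where R: "mutually_inverse m (Lambda m 0 b - L) R" "R $$ (0, 0) = elem_inv (b - P)"
      using R'[OF inv] unfolding m_def by blast
    \<comment> \<open>The premise stands under the existential quantifier so that \<open>G\<close>
      becomes a total function, with arbitrary values at \<epsilon> \<le> 0.\<close>
    have "\<forall>\<epsilon>. \<exists>G. \<epsilon> > 0 \<longrightarrow> mutually_inverse m (Lambda m \<epsilon> b - L) G"
      using Lambda_minus_invertible[OF L'(1,2) pos d(1)] unfolding m_def by blast
    then obtain G where G: "\<And>\<epsilon>. \<epsilon> > 0 \<Longrightarrow> mutually_inverse m (Lambda m \<epsilon> b - L) (G \<epsilon>)"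
      by metis
    define C where "C = entry_norm R"
    have C: "C \<ge> 0" by (simp add: C_def entry_norm_nonneg)
    have lim0: "((\<lambda>\<epsilon>. real (m * m) * \<epsilon> * K) \<longlongrightarrow> 0) (at_right 0)" for K
      by (auto intro!: tendsto_eq_intros)
    have pos_ev: "eventually (\<lambda>\<epsilon>. \<epsilon> > (0::real)) (at_right 0)"
      by (rule eventually_at_right_less)
    \<comment> \<open>\<open>C\<close> belongs to the inverse at \<epsilon> = 0 and does not vary,
      so the smallness condition of the perturbation estimate holds near 0.\<close>
    have "eventually (\<lambda>\<epsilon>. real (m * m) * \<epsilon> * C < 1 / 2) (at_right 0)"
      using order_tendstoD(2)[OF lim0[of C], of "1 / 2"] by simp
    with pos_ev have bound: "eventually (\<lambda>\<epsilon>. norm (G \<epsilon> $$ (0, 0) - elem_inv (b - P))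
        \<le> real (m * m) * \<epsilon> * (2 * C\<^sup>2)) (at_right 0)"
    proof eventually_elim
      case (elim \<epsilon>)
      let ?e = "entry_norm ((Lambda m \<epsilon> b - L) - (Lambda m 0 b - L))"
      have e: "?e \<le> real (m * m) * \<epsilon>"
        using elim(1) by (intro entry_norm_Lambda_diff L(1)) simp
      then have "?e * C \<le> real (m * m) * \<epsilon> * C" using C by (rule mult_right_mono)
      then have "?e * entry_norm R \<le> 1 / 2" using elim(2) by (simp add: C_def)
      from mutually_inverse_perturbation[OF R(1) G[OF elim(1)] this]
      have "entry_norm (G \<epsilon> - R) \<le> 2 * C\<^sup>2 * ?e" by (simp add: C_def)
      also have "\<dots> \<le> 2 * C\<^sup>2 * (real (m * m) * \<epsilon>)" using e by (intro mult_left_mono) auto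
      finally have "entry_norm (G \<epsilon> - R) \<le> real (m * m) * \<epsilon> * (2 * C\<^sup>2)" by (simp add: mult_ac)
      moreover have c: "G \<epsilon> \<in> carrier_mat m m" "R \<in> carrier_mat m m"
        using G[OF elim(1)] R(1) by (auto simp: mutually_inverse_def)
      have "norm ((G \<epsilon> - R) $$ (0, 0)) \<le> entry_norm (G \<epsilon> - R)"
        by (rule norm_index_le_entry_norm) (use c in \<open>auto simp: m_def\<close>)
      moreover have "(G \<epsilon> - R) $$ (0, 0) = G \<epsilon> $$ (0, 0) - elem_inv (b - P)"
        using c by (simp add: m_def R(2))
      ultimately show ?case by simp
    qed
    have "((\<lambda>\<epsilon>. G \<epsilon> $$ (0, 0) - elem_inv (b - P)) \<longlongrightarrow> 0) (at_right 0)"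
      by (rule Lim_null_comparison[OF bound lim0])
    then have "((\<lambda>\<epsilon>. F (G \<epsilon> $$ (0, 0))) \<longlongrightarrow> F (elem_inv (b - P))) (at_right 0)"
      by (rule tendsto_F[OF LIM_zero_cancel])
    \<comment> \<open>\<open>G \<epsilon>\<close> is known to be the ring inverse only for positive
      \<epsilon>, which suffices for a limit from the right.\<close>
    moreover have "eventually (\<lambda>\<epsilon>. F (G \<epsilon> $$ (0, 0)) =
        matrix_cauchy_transform m F L (Lambda m \<epsilon> b) $$ (0, 0)) (at_right 0)"
      using pos_ev
    proof eventually_elim
      case (elim \<epsilon>)
      have "G \<epsilon> \<in> carrier_mat m m" using G[OF elim] by (simp add: mutually_inverse_def)
      then show ?case
        unfolding matrix_cauchy_transform_def mutually_inverse_Units(2)[OF G[OF elim]]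
        by (simp add: m_def)
    qed
    ultimately have "((\<lambda>\<epsilon>. matrix_cauchy_transform m F L (Lambda m \<epsilon> b) $$ (0, 0))
          \<longlongrightarrow> cauchy_transform F P b) (at_right 0)"
      unfolding cauchy_transform_def by (rule Lim_transform_eventually)
    moreover have "\<forall>\<epsilon>>0. Lambda m \<epsilon> b - L \<in> Units (matrix_algebra TYPE('a) m)"
      by (auto intro: mutually_inverse_Units(1) G)
    ultimately show ?thesis using inv by blast
  qed
  have "L \<in> carrier (matrix_algebra TYPE('a) m)" using L(1) by (simp add: ring_mat_simps)
  moreover have "m \<ge> 1" by (simp add: m_def)
  ultimately show ?thesis
    using selfadjoint_affine_decomposition[OF B(1) L] spec by blast
qed

end
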